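(* Let $f$ be an analytic function over $(-1,1)^d$. Assume that the power series $f(\boldsymbol{x})=\sum_{\boldsymbol{k}\in\mathbb{N}^d}a_{\boldsymbol{k}}\boldsymbol{x}^{\boldsymbol{k}}$ is absolutely convergent in $[-1,1]^d$. Then for any $\delta>0$, there exists a function $\hat f$ that can be represented by a deep ReLU network with depth $L$ and width $d+4$, such that $$|f(\boldsymbol{x})-\hat f(\boldsymbol{x})|<2\sum_{\boldsymbol{k}\in\mathbb{N}^d}|a_{\boldsymbol{k}}|\cdot\exp\left(-d\delta\left(e^{-1}L^{1/(2d)}-1\right)\right)$$ for all $\boldsymbol{x}\in[-1+\delta,1-\delta]^d$.
   Context: Here $\mathbb{N}=\{0,1,2,\dots\}$, $\boldsymbol{x}=(x_1,\dots,x_d)$ and $\boldsymbol{x}^{\boldsymbol{k}}=x_1^{k_1}\cdots x_d^{k_d}$. $\mathrm{ReLU}(t)=\max(t,0)$. A ReLU network on $\mathbb{R}^d$ is a standard fully connected feedforward network (connections only between adjacent layers): every node of the first hidden layer is $\mathrm{ReLU}$ of an affine function of the inputs $x_1,\dots,x_d$; every node of each later hidden layer is $\mathrm{ReLU}$ of an affine function of the nodes of the preceding hidden layer; the output is an affine function of the nodes of the last hidden layer. Its width is the number of nodes in each hidden layer. Its depth is its number of layers, with the output layer counted, so that a network with $H$ hidden layers has depth $H+1$. The letter $L$ in the bound is the depth of the network.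
   Formalization: The coefficients a_k are assumed not all zero: for f = 0 the right-hand side is 0 and the strict inequality fails whenever δ ≤ 1. *)

theory Defs
  imports "HOL-Analysis.Analysis"
begin

definition monom_val :: "real ^ 'd \<Rightarrow> nat ^ 'd \<Rightarrow> real" where
  "monom_val x k = (\<Prod>i\<in>UNIV. (x $ i) ^ (k $ i))"

(* For real summands, has_sum is unconditional, hence absolute, convergence.
   The definition is meant for open S; r may always be shrunk so that the ball lies in S,
   so values of f outside S play no role. *)
definition real_analytic_on :: "(real ^ 'd \<Rightarrow> real) \<Rightarrow> (real ^ 'd) set \<Rightarrow> bool" where
  "real_analytic_on f S \<longleftrightarrow>
     (\<forall>c\<in>S. \<exists>r>0. \<exists>b :: nat ^ 'd \<Rightarrow> real.
        \<forall>y\<in>ball c r. ((\<lambda>k. b k * monom_val (y - c) k) has_sum f y) UNIV)"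

definition relu :: "real \<Rightarrow> real" where
  "relu t = max t 0"

(* relu_layer w V W B l j x is node j < w of hidden layer l on input x, layers counted from 0;
   V j is the weight vector of node j of layer 0, W l j i the weight from node i of layer l
   to node j of layer l + 1, and B l j the bias of node j of layer l. *)
primrec relu_layer ::
  "nat \<Rightarrow> (nat \<Rightarrow> real ^ 'd) \<Rightarrow> (nat \<Rightarrow> nat \<Rightarrow> nat \<Rightarrow> real) \<Rightarrow> (nat \<Rightarrow> nat \<Rightarrow> real)
     \<Rightarrow> nat \<Rightarrow> nat \<Rightarrow> real ^ 'd \<Rightarrow> real" where
  "relu_layer w V W B 0 = (\<lambda>j x. relu (V j \<bullet> x + B 0 j))"
| "relu_layer w V W B (Suc l) =
     (\<lambda>j x. relu ((\<Sum>i<w. W l j i * relu_layer w V W B l i x) + B (Suc l) j))"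

(* Depth L counts the output layer, and there is at least one hidden layer.
   Every hidden layer has exactly w nodes. *)
definition relu_network_fun :: "nat \<Rightarrow> nat \<Rightarrow> (real ^ 'd \<Rightarrow> real) \<Rightarrow> bool" where
  "relu_network_fun L w g \<longleftrightarrow>
     (\<exists>H V W B c c0. 1 \<le> H \<and> L = H + 1 \<and>
        (\<forall>x. g x = (\<Sum>j<w. c j * relu_layer w V W B (H - 1) j x) + c0))"

end

theory Submission
  imports Defs "HOL-Combinatorics.Stirling"
begin

text \<open>
  Truncate the series at total degree \<open>q\<close>, where \<open>q + 1\<close> is about \<open>d (L\<^bsup>1/(2d)\<^esup> / e - 1)\<close>. On the
  smaller cube the tail is at most a factor \<open>exp (- \<delta> (q + 1))\<close> of the coefficient sum, and \<open>L\<close>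
  exceeds \<open>(e (q + d) / d) ^ (2 d)\<close>, roughly the square of the number of monomials of degree at
  most \<open>q\<close>. That many layers have to suffice to evaluate the truncated polynomial.

  Of the \<open>d + 4\<close> nodes of a layer, \<open>d\<close> transport the inputs and one is the actual nonlinearity, so three
  linear registers are left. Squaring with iterated tent maps needs a running tent iterate and a
  running sum. Hence one register remains for the accumulated result, and multiplying a stored
  monomial by a variable, which would need one register more, is not available. If \<open>d = 1\<close>, Horner's
  scheme avoids the problem. If \<open>d \<ge> 2\<close>, every monomial of degree at most \<open>M = 2 ^ n\<close> is written as
  a combination of the powers \<open>(M - j \<bullet> x) ^ M\<close> over the lattice points \<open>j\<close> of a simplex, with
  weights obtained from Newton's interpolation formula, and each power is computed by \<open>n\<close>
  squarings in place.
\<close>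

section \<open>Networks as register machines\<close>

text \<open>The inputs travel through every layer, so the coordinates are free generators besides
  the registers \<open>G\<close>. Equality is asked on \<open>X\<close> only, because a shifted
  quantity passes a ReLU unchanged only where it is bounded below.\<close>

inductive aff_span :: "(real ^ 'd) set \<Rightarrow> (real ^ 'd \<Rightarrow> real) set \<Rightarrow> (real ^ 'd \<Rightarrow> real) \<Rightarrow> bool"
  for X :: "(real ^ 'd) set" and G :: "(real ^ 'd \<Rightarrow> real) set" where
  aff_span_base: "g \<in> G \<Longrightarrow> aff_span X G g"
| aff_span_coord: "aff_span X G (\<lambda>x. x $ i)"
| aff_span_const: "aff_span X G (\<lambda>x. c)"
| aff_span_add: "aff_span X G g \<Longrightarrow> aff_span X G h \<Longrightarrow> aff_span X G (\<lambda>x. g x + h x)"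
| aff_span_scale: "aff_span X G g \<Longrightarrow> aff_span X G (\<lambda>x. c * g x)"
| aff_span_cong: "aff_span X G g \<Longrightarrow> (\<And>x. x \<in> X \<Longrightarrow> h x = g x) \<Longrightarrow> aff_span X G h"

lemma aff_span_diff: "aff_span X G g \<Longrightarrow> aff_span X G h \<Longrightarrow> aff_span X G (\<lambda>x. g x - h x)"
  using aff_span_add[OF _ aff_span_scale[of X G h "-1"], of g] by simp

lemma aff_span_sum:
  "finite I \<Longrightarrow> (\<And>i. i \<in> I \<Longrightarrow> aff_span X G (g i)) \<Longrightarrow> aff_span X G (\<lambda>x. \<Sum>i\<in>I. g i x)"
  by (induction I rule: finite_induct) (auto intro: aff_span_const aff_span_add)

definition layer_comb ::
  "nat \<Rightarrow> (nat \<Rightarrow> real ^ 'd) \<Rightarrow> (nat \<Rightarrow> nat \<Rightarrow> nat \<Rightarrow> real) \<Rightarrow> (nat \<Rightarrow> nat \<Rightarrow> real)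
     \<Rightarrow> (real ^ 'd) set \<Rightarrow> nat \<Rightarrow> (real ^ 'd \<Rightarrow> real) \<Rightarrow> bool" where
  "layer_comb w V W B X H g \<longleftrightarrow>
     (\<exists>c c0. \<forall>x\<in>X. g x = (\<Sum>j<w. c j * relu_layer w V W B H j x) + c0)"

text \<open>The weights are chosen before \<open>g\<close>, so that all registers can be read from
  the same layer at once. \<open>H\<close> is the index of that layer, counted from 0.\<close>

definition in_layer :: "(real ^ 'd) set \<Rightarrow> nat \<Rightarrow> (real ^ 'd \<Rightarrow> real) set \<Rightarrow> bool" where
  "in_layer X H G \<longleftrightarrow> (\<exists>V W B. \<forall>g. aff_span X G g \<longrightarrow> layer_comb (CARD('d) + 4) V W B X H g)"

lemma layer_comb_aff_span:
  assumes "aff_span X G g"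
    and "\<And>g. g \<in> G \<Longrightarrow> layer_comb w V W B X H g"
    and "\<And>i. layer_comb w V W B X H (\<lambda>x. x $ i)"
  shows "layer_comb w V W B X H g"
  using assms(1)
proof induction
  case (aff_span_const c)
  show ?case unfolding layer_comb_def
    by (rule exI[of _ "\<lambda>_. 0"], rule exI[of _ c]) simp
next
  case (aff_span_add g h)
  then obtain c c0 d d0 where
    "\<forall>x\<in>X. g x = (\<Sum>j<w. c j * relu_layer w V W B H j x) + c0"
    "\<forall>x\<in>X. h x = (\<Sum>j<w. d j * relu_layer w V W B H j x) + d0"
    unfolding layer_comb_def by blast
  then show ?case unfolding layer_comb_def
    by (intro exI[of _ "\<lambda>j. c j + d j"] exI[of _ "c0 + d0"])
       (simp add: distrib_right sum.distrib)
next
  case (aff_span_scale g a)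
  then obtain c c0 where
    "\<forall>x\<in>X. g x = (\<Sum>j<w. c j * relu_layer w V W B H j x) + c0"
    unfolding layer_comb_def by blast
  then show ?case unfolding layer_comb_def
    by (intro exI[of _ "\<lambda>j. a * c j"] exI[of _ "a * c0"])
       (simp add: distrib_left sum_distrib_left mult.assoc)
next
  case (aff_span_cong g h)
  then show ?case unfolding layer_comb_def by metis
qed (use assms(2,3) in auto)

lemma aff_span_trans:
  "aff_span X G' g \<Longrightarrow> (\<And>h. h \<in> G' \<Longrightarrow> aff_span X G h) \<Longrightarrow> aff_span X G g"
  by (induction rule: aff_span.induct) (auto intro: aff_span.intros)

lemma in_layer_mix: "in_layer X H G \<Longrightarrow> (\<And>g. g \<in> G' \<Longrightarrow> aff_span X G g) \<Longrightarrow> in_layer X H G'"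
  unfolding in_layer_def using aff_span_trans[of X G' _ G] by blast

section \<open>Extending a network by one layer, and padding it to a given depth\<close>

lemma relu_layer_cong:
  assumes "\<And>l j i. l < H \<Longrightarrow> W l j i = W' l j i" "\<And>l j. l \<le> H \<Longrightarrow> B l j = B' l j"
  shows "relu_layer w V W B H j x = relu_layer w V W' B' H j x"
  using assms by (induction H arbitrary: j) auto

lemma continuous_relu_layer: "continuous_on X (relu_layer w V W B H j)"
proof (induction H arbitrary: j)
  case 0
  show ?case unfolding relu_layer.simps relu_def by (intro continuous_intros)
next
  case (Suc H)
  show ?case unfolding relu_layer.simps relu_def by (intro continuous_intros Suc)
qed

lemma layer_comb_bounded:
  fixes X :: "(real ^ 'd) set"
  assumes "compact X" "layer_comb w V W B X H g"
  shows "\<exists>K. \<forall>x\<in>X. 0 \<le> g x + K"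
proof -
  from assms(2) obtain c c0 where
    c: "\<forall>x\<in>X. g x = (\<Sum>j<w. c j * relu_layer w V W B H j x) + c0"
    unfolding layer_comb_def by blast
  have "continuous_on X (\<lambda>x. (\<Sum>j<w. c j * relu_layer w V W B H j x) + c0)"
    by (intro continuous_intros continuous_relu_layer)
  then have "continuous_on X g"
    by (rule continuous_on_eq) (use c in simp)
  then have "bounded (g ` X)"
    using assms(1) compact_continuous_image compact_imp_bounded by blast
  then obtain K where "\<forall>x\<in>X. \<bar>g x\<bar> \<le> K"
    unfolding bounded_real by blast
  then show ?thesis by (intro exI[of _ K]) fastforce
qed

text \<open>The shift \<open>K\<close> bounds the norm on \<open>X\<close>, so the ReLU of a
  coordinate plus \<open>K\<close> is affine there and the coordinate can be read off.\<close>

lemma in_layer_init: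
  fixes X :: "(real ^ 'd) set"
  assumes "compact X"
  shows "in_layer X 0 {}"
proof -
  define w where "w = CARD('d) + 4"
  obtain e where e: "bij_betw e {..<CARD('d)} (UNIV :: 'd set)"
    using ex_bij_betw_nat_finite[of "UNIV :: 'd set"] by (auto simp: atLeast0LessThan)
  have "bounded X" using assms compact_imp_bounded by blast
  then obtain K where K: "\<And>x. x \<in> X \<Longrightarrow> norm x \<le> K" unfolding bounded_iff by blast
  define V where "V = (\<lambda>j. axis (e j) (1 :: real))"
  define B where "B = (\<lambda>(l::nat) (j::nat). K)"
  define W where "W = (\<lambda>(l::nat) (j::nat) (i::nat). 0 :: real)"
  have coord: "layer_comb w V W B X 0 (\<lambda>x. x $ i)" for i
  proof -
    obtain j where j: "j < CARD('d)" "e j = i"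
      using e unfolding bij_betw_def by (metis UNIV_I imageE lessThan_iff)
    have "x $ i = (\<Sum>j'<w. (if j' = j then 1 else 0) * relu_layer w V W B 0 j' x) + - K"
      if "x \<in> X" for x
    proof -
      have "\<bar>x $ i\<bar> \<le> K" using K[OF that] component_le_norm_cart[of x i] by linarith
      then have "relu_layer w V W B 0 j x = x $ i + K"
        by (simp add: V_def B_def j relu_def inner_axis' )
      moreover have "j < w" using j by (simp add: w_def)
      ultimately show ?thesis by (simp add: if_distrib[of "\<lambda>z. z * _"] cong: if_cong)
    qed
    then show ?thesis unfolding layer_comb_def
      by (intro exI[of _ "\<lambda>j'. if j' = j then 1 else 0"] exI[of _ "- K"]) blast
  qed
  show ?thesis unfolding in_layer_def w_def[symmetric]
    by (intro exI[of _ V] exI[of _ W] exI[of _ B] allI impI, rule layer_comb_aff_span)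
       (use coord in auto)
qed

text \<open>Linear quantities are bounded on the compact set \<open>X\<close>, so after adding a constant they pass
  through a ReLU unchanged; one node per layer is left for a genuine nonlinearity.\<close>

lemma in_layer_step:
  fixes X :: "(real ^ 'd) set"
  assumes X: "compact X" and G: "in_layer X H G"
    and h: "aff_span X G h1" "aff_span X G h2" "aff_span X G h3" "aff_span X G l"
  shows "in_layer X (Suc H) {h1, h2, h3, \<lambda>x. relu (l x)}"
proof -
  define w where "w = CARD('d) + 4"
  from G obtain V W B where lc: "\<And>g. aff_span X G g \<Longrightarrow> layer_comb w V W B X H g"
    unfolding in_layer_def w_def by blast
  obtain e where e: "bij_betw e {..<CARD('d)} (UNIV :: 'd set)"
    using ex_bij_betw_nat_finite[of "UNIV :: 'd set"] by (auto simp: atLeast0LessThan)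
  \<comment> \<open>Pre-activations before shifting: the inputs, then three linear registers, and
    the nonlinear node at index \<open>CARD('d) + 3\<close>.\<close>
  define P where "P = (\<lambda>j. if j < CARD('d) then (\<lambda>x. x $ e j) else if j = CARD('d) then h1
     else if j = CARD('d) + 1 then h2 else if j = CARD('d) + 2 then h3 else l)"
  have Paff: "aff_span X G (P j)" for j
    unfolding P_def by (auto intro: aff_span_coord h)
  have "\<exists>c c0. \<forall>x\<in>X. P j x = (\<Sum>i<w. c i * relu_layer w V W B H i x) + c0" for j
    using lc[OF Paff[of j]] unfolding layer_comb_def .
  then obtain C C0 where C:
    "\<And>j x. x \<in> X \<Longrightarrow> P j x = (\<Sum>i<w. C j i * relu_layer w V W B H i x) + C0 j"
    by metis
  have "\<exists>K. \<forall>x\<in>X. 0 \<le> P j x + K" for j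
    using layer_comb_bounded[OF X lc[OF Paff]] .
  then obtain K' where K': "\<And>j x. x \<in> X \<Longrightarrow> 0 \<le> P j x + K' j" by metis
  \<comment> \<open>No shift for the last node, whose ReLU is meant to cut off.\<close>
  define K where "K = (\<lambda>j. if j < CARD('d) + 3 then K' j else 0)"
  define W' where "W' = W(H := C)"
  define B' where "B' = B(Suc H := (\<lambda>j. C0 j + K j))"
  have "relu_layer w V W' B' H j x = relu_layer w V W B H j x" for j x
    by (rule relu_layer_cong) (auto simp: W'_def B'_def)
  then have node: "relu_layer w V W' B' (Suc H) j x = relu (P j x + K j)" if "x \<in> X" for j x
    using C[OF that, of j] by (simp add: W'_def B'_def add.assoc)
  have single: "layer_comb w V W' B' X (Suc H) g"
    if "j < w" "\<And>x. x \<in> X \<Longrightarrow> g x = relu (P j x + K j) - k" for j g k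
  proof -
    have "g x = (\<Sum>j'<w. (if j' = j then 1 else 0) * relu_layer w V W' B' (Suc H) j' x) + - k"
      if "x \<in> X" for x
      using that \<open>j < w\<close> \<open>\<And>x. x \<in> X \<Longrightarrow> g x = _\<close>[OF that] node[OF that]
      by (simp add: if_distrib[of "\<lambda>z. z * _"] del: relu_layer.simps cong: if_cong)
    then show ?thesis unfolding layer_comb_def
      by (intro exI[of _ "\<lambda>j'. if j' = j then 1 else 0"] exI[of _ "- k"]) blast
  qed
  have pass: "layer_comb w V W' B' X (Suc H) (P j)" if "j < CARD('d) + 3" for j
    using that K' by (intro single[of j _ "K j"]) (auto simp: w_def K_def relu_def)
  have coord: "layer_comb w V W' B' X (Suc H) (\<lambda>x. x $ i)" for i
  proof -
    obtain j where "j < CARD('d)" "e j = i"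
      using e unfolding bij_betw_def by (metis UNIV_I imageE lessThan_iff)
    then show ?thesis using pass[of j] by (simp add: P_def)
  qed
  have "layer_comb w V W' B' X (Suc H) (\<lambda>x. relu (l x))"
    by (rule single[of "CARD('d) + 3" _ 0]) (auto simp: w_def K_def P_def)
  moreover have "layer_comb w V W' B' X (Suc H) h1" "layer_comb w V W' B' X (Suc H) h2"
      "layer_comb w V W' B' X (Suc H) h3"
    using pass[of "CARD('d)"] pass[of "CARD('d) + 1"] pass[of "CARD('d) + 2"]
    by (simp_all add: P_def)
  ultimately have "g \<in> {h1, h2, h3, \<lambda>x. relu (l x)} \<Longrightarrow> layer_comb w V W' B' X (Suc H) g" for g
    by auto
  then show ?thesis unfolding in_layer_def w_def[symmetric]
    by (intro exI[of _ V] exI[of _ W'] exI[of _ B'] allI impI, elim layer_comb_aff_span)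
       (use coord in auto)
qed

text \<open>The depth has to be exactly \<open>L\<close>, while the constructions only bound it from
  above; surplus layers copy the result.\<close>

lemma in_layer_idle:
  assumes "compact X" "in_layer X H {g}"
  shows "in_layer X (H + n) {g}"
proof (induction n)
  case (Suc n)
  have "in_layer X (Suc (H + n)) {g, g, g, \<lambda>x. relu (g x)}"
    by (rule in_layer_step[OF assms(1) Suc]) (auto intro: aff_span_base)
  then show ?case by (auto intro: in_layer_mix aff_span_base)
qed (use assms in simp)

text \<open>With numbering from 0, layer \<open>H\<close> is hidden layer number
  \<open>H + 1\<close>; the output layer makes the depth \<open>H + 2\<close>.\<close>

lemma in_layer_network:
  fixes X :: "(real ^ 'd) set"
  assumes "compact X" "in_layer X H {g}" "H + 2 \<le> L"
  shows "\<exists>fhat. relu_network_fun L (CARD('d) + 4) fhat \<and> (\<forall>x\<in>X. fhat x = g x)"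
proof -
  define H' where "H' = L - 2"
  have "in_layer X H' {g}"
    using in_layer_idle[OF assms(1,2), of "H' - H"] assms(3) by (simp add: H'_def)
  then obtain V W B where "layer_comb (CARD('d) + 4) V W B X H' g"
    unfolding in_layer_def using aff_span_base by blast
  then obtain c c0 where c:
    "\<forall>x\<in>X. g x = (\<Sum>j<CARD('d) + 4. c j * relu_layer (CARD('d) + 4) V W B H' j x) + c0"
    unfolding layer_comb_def by blast
  show ?thesis unfolding relu_network_fun_def
    by (rule exI[of _ "\<lambda>x. (\<Sum>j<CARD('d) + 4. c j * relu_layer (CARD('d) + 4) V W B H' j x) + c0"],
        intro conjI exI[of _ "Suc H'"] exI[of _ V] exI[of _ W] exI[of _ B] exI[of _ c] exI[of _ c0])
       (use c assms(3) in \<open>auto simp: H'_def\<close>)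
qed

section \<open>Squaring by iterated tent maps\<close>

text \<open>On [0,1] this is the tent map. For nonnegative arguments the usual term
  \<open>2 * relu t\<close> equals \<open>2 * t\<close>, so one ReLU per iteration is
  enough.\<close>

definition tent :: "real \<Rightarrow> real" where
  "tent t = 2 * t - 4 * relu (t - 1 / 2)"

text \<open>On [0,1] this is the piecewise linear interpolant of the square at the multiples of
  \<open>1 / 2 ^ s\<close>.\<close>

definition sq_approx :: "nat \<Rightarrow> real \<Rightarrow> real" where
  "sq_approx s t = t - (\<Sum>j<s. (tent ^^ Suc j) t / 4 ^ Suc j)"

lemma tent_bounds: "0 \<le> t \<Longrightarrow> t \<le> 1 \<Longrightarrow> 0 \<le> tent t \<and> tent t \<le> 1"
  by (auto simp: tent_def relu_def max_def)

lemma tent_funpow_bounds: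
  "0 \<le> t \<Longrightarrow> t \<le> 1 \<Longrightarrow> 0 \<le> (tent ^^ j) t \<and> (tent ^^ j) t \<le> 1"
  by (induction j) (auto intro: tent_bounds[THEN conjunct1] tent_bounds[THEN conjunct2])

text \<open>Self-similarity of \<open>t - t ^ 2\<close> under the tent map; iterating it yields the
  series cut off in \<open>sq_approx\<close>.\<close>

lemma tent_square: "0 \<le> t \<Longrightarrow> t \<le> 1 \<Longrightarrow> t - t\<^sup>2 = tent t / 4 + (tent t - (tent t)\<^sup>2) / 4"
  by (auto simp: tent_def relu_def max_def power2_eq_square field_simps)

lemma sq_approx_error:
  assumes "0 \<le> t" "t \<le> 1"
  shows "sq_approx s t - t\<^sup>2 = ((tent ^^ s) t - ((tent ^^ s) t)\<^sup>2) / 4 ^ s"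
proof (induction s)
  case (Suc s)
  define u where "u = (tent ^^ s) t"
  have "0 \<le> u" "u \<le> 1" using tent_funpow_bounds[OF assms] by (auto simp: u_def)
  then have u: "u - u\<^sup>2 = tent u / 4 + (tent u - (tent u)\<^sup>2) / 4" by (rule tent_square)
  have "sq_approx (Suc s) t - t\<^sup>2 = (sq_approx s t - t\<^sup>2) - tent u / 4 ^ Suc s"
    by (simp add: sq_approx_def u_def)
  also have "\<dots> = (u - u\<^sup>2) / 4 ^ s - tent u / 4 ^ Suc s"
    using Suc by (simp add: u_def)
  also have "\<dots> = (tent u - (tent u)\<^sup>2) / 4 ^ Suc s"
    unfolding u by (simp add: field_simps)
  finally show ?case by (simp add: u_def)
qed (simp add: sq_approx_def)

text \<open>The parabola \<open>u - u ^ 2\<close> lies between 0 and 1/4 on [0,1]. The approximation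
  errs only upwards yet never exceeds \<open>t\<close>, which keeps iterates in [0,1].\<close>

lemma sq_approx_bounds:
  assumes "0 \<le> t" "t \<le> 1"
  shows "t\<^sup>2 \<le> sq_approx s t" "sq_approx s t \<le> t\<^sup>2 + 1 / 4 ^ Suc s" "sq_approx s t \<le> t"
proof -
  define u where "u = (tent ^^ s) t"
  have u: "0 \<le> u" "u \<le> 1" using tent_funpow_bounds[OF assms] by (auto simp: u_def)
  have "u\<^sup>2 \<le> u" using u by (simp add: power2_eq_square mult_left_le)
  moreover have "u - u\<^sup>2 \<le> 1 / 4"
    using zero_le_power2[of "u - 1 / 2"] by (simp add: power2_eq_square algebra_simps)
  ultimately have "0 \<le> (u - u\<^sup>2) / 4 ^ s" "(u - u\<^sup>2) / 4 ^ s \<le> (1 / 4) / 4 ^ s"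
    by (simp, intro divide_right_mono, simp_all)
  then have "0 \<le> (u - u\<^sup>2) / 4 ^ s" "(u - u\<^sup>2) / 4 ^ s \<le> 1 / 4 ^ Suc s" by simp_all
  then show "t\<^sup>2 \<le> sq_approx s t" "sq_approx s t \<le> t\<^sup>2 + 1 / 4 ^ Suc s"
    using sq_approx_error[OF assms, of s] by (simp_all add: u_def)
  have "0 \<le> (\<Sum>j<s. (tent ^^ Suc j) t / 4 ^ Suc j)"
    using tent_funpow_bounds[OF assms]
    by (intro sum_nonneg divide_nonneg_nonneg) (simp_all del: funpow.simps)
  then show "sq_approx s t \<le> t" by (simp add: sq_approx_def)
qed

lemma sq_approx_unit: "0 \<le> t \<Longrightarrow> t \<le> 1 \<Longrightarrow> 0 \<le> sq_approx s t \<and> sq_approx s t \<le> 1"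
  using sq_approx_bounds[of t s] zero_le_power2[of t] by linarith

text \<open>The three linear registers hold the passive \<open>A\<close>, the running sum and the
  current tent iterate; the nonlinear node makes one tent step per layer. Adding the square onto
  \<open>r\<close> is what later permits differences of squares.\<close>

lemma in_layer_square:
  fixes X :: "(real ^ 'd) set"
  assumes X: "compact X" and G: "in_layer X H G"
    and aff: "aff_span X G A" "aff_span X G r" "aff_span X G t"
    and t: "\<And>x. x \<in> X \<Longrightarrow> 0 \<le> t x \<and> t x \<le> 1"
  shows "in_layer X (H + s) {A, \<lambda>x. r x + c * sq_approx s (t x)}"
proof -
  define R where "R = (\<lambda>s x. r x + c * sq_approx s (t x))"
  define T where "T = (\<lambda>s x. (tent ^^ s) (t x))"
  have "in_layer X (H + s) {A, R s, T s}"
  proof (induction s)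
    case 0
    have "aff_span X G (\<lambda>x. r x + c * t x)" using aff by (intro aff_span_add aff_span_scale)
    then have "aff_span X G (R 0)" "aff_span X G (T 0)" using aff by (simp_all add: R_def T_def sq_approx_def)
    then have "in_layer X H {A, R 0, T 0}" using aff(1) by (intro in_layer_mix[OF G]) auto
    then show ?case by simp
  next
    case (Suc s)
    define F where "F = (\<lambda>x. relu (T s x - 1 / 2))"
    have "in_layer X (Suc (H + s)) {A, R s, T s, F}"
      unfolding F_def
      by (rule in_layer_step[OF X Suc]) (auto intro: aff_span_base aff_span_diff aff_span_const)
    moreover have T: "aff_span X {A, R s, T s, F} (T (Suc s))"
    proof -
      have "aff_span X {A, R s, T s, F} (\<lambda>x. 2 * T s x - 4 * F x)"
        by (intro aff_span_diff aff_span_scale aff_span_base) auto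
      then show ?thesis by (simp add: T_def F_def tent_def)
    qed
    moreover have "aff_span X {A, R s, T s, F} (R (Suc s))"
    proof -
      have "aff_span X {A, R s, T s, F} (\<lambda>x. R s x - (c / 4 ^ Suc s) * T (Suc s) x)"
        by (intro aff_span_diff aff_span_scale aff_span_base T) auto
      then show ?thesis by (simp add: R_def T_def sq_approx_def algebra_simps)
    qed
    moreover have "aff_span X {A, R s, T s, F} A" by (rule aff_span_base) simp
    ultimately have "in_layer X (Suc (H + s)) {A, R (Suc s), T (Suc s)}" by (elim in_layer_mix) auto
    then show ?case by simp
  qed
  then have "in_layer X (H + s) {A, R s}" by (rule in_layer_mix) (auto intro: aff_span_base)
  then show ?thesis by (simp add: R_def)
qed

text \<open>One nonlinear node is enough, since \<open>\<bar>u\<bar> = 2 * relu u - u\<close> with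
  \<open>u\<close> itself carried along.\<close>

lemma in_layer_abs:
  fixes X :: "(real ^ 'd) set"
  assumes X: "compact X" and G: "in_layer X H G" and aff: "aff_span X G A" "aff_span X G r" "aff_span X G u"
  shows "in_layer X (Suc H) {A, r, \<lambda>x. \<bar>u x\<bar>}"
proof -
  let ?G = "{A, r, u, \<lambda>x. relu (u x)}"
  have "in_layer X (Suc H) ?G" by (rule in_layer_step[OF X G aff aff(3)])
  moreover have "aff_span X ?G (\<lambda>x. 2 * relu (u x) - u x)"
    by (rule aff_span_diff[OF aff_span_scale]) (auto intro: aff_span_base)
  then have "aff_span X ?G (\<lambda>x. \<bar>u x\<bar>)"
    by (rule aff_span_cong) (auto simp: relu_def max_def)
  moreover have "aff_span X ?G A" "aff_span X ?G r" by (auto intro: aff_span_base)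
  ultimately show ?thesis by (elim in_layer_mix) auto
qed

section \<open>Repeated squaring, and sums of powers of affine functions\<close>

lemma funpow_sq_approx_unit:
  "0 \<le> t \<Longrightarrow> t \<le> 1 \<Longrightarrow> 0 \<le> (sq_approx s ^^ n) t \<and> (sq_approx s ^^ n) t \<le> 1"
  by (induction n) (auto intro: sq_approx_unit[THEN conjunct1] sq_approx_unit[THEN conjunct2])

text \<open>Squaring is 2-Lipschitz on [0,1], so each round doubles the error and adds
  \<open>1 / 4 ^ Suc s\<close>; this recursion gives the factor \<open>2 ^ n - 1\<close>.\<close>

lemma funpow_sq_approx_error:
  assumes "0 \<le> t" "t \<le> 1"
  shows "\<bar>(sq_approx s ^^ n) t - t ^ (2 ^ n)\<bar> \<le> (2 ^ n - 1) / 4 ^ Suc s"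
proof (induction n)
  case (Suc n)
  define y where "y = (sq_approx s ^^ n) t"
  define z where "z = t ^ (2 ^ n)"
  have y: "0 \<le> y" "y \<le> 1" using funpow_sq_approx_unit[OF assms] by (auto simp: y_def)
  have z: "0 \<le> z" "z \<le> 1" using assms by (auto simp: z_def power_le_one)
  have "\<bar>sq_approx s y - y\<^sup>2\<bar> \<le> 1 / 4 ^ Suc s"
    using sq_approx_bounds[OF y, of s] by linarith
  moreover have "\<bar>y\<^sup>2 - z\<^sup>2\<bar> \<le> 2 * \<bar>y - z\<bar>"
  proof -
    have "\<bar>y\<^sup>2 - z\<^sup>2\<bar> = \<bar>y + z\<bar> * \<bar>y - z\<bar>"
      unfolding abs_mult[symmetric] by (simp add: power2_eq_square algebra_simps)
    also have "\<dots> \<le> 2 * \<bar>y - z\<bar>" using y z by (intro mult_right_mono) auto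
    finally show ?thesis .
  qed
  moreover have "\<bar>y - z\<bar> \<le> (2 ^ n - 1) / 4 ^ Suc s"
    using Suc by (simp add: y_def z_def)
  ultimately have "\<bar>sq_approx s y - z\<^sup>2\<bar> \<le> 2 * ((2 ^ n - 1) / 4 ^ Suc s) + 1 / 4 ^ Suc s"
    unfolding abs_le_iff by (smt (verit))
  also have "\<dots> = (2 ^ Suc n - 1) / 4 ^ Suc s" by (simp add: field_simps)
  also have "z\<^sup>2 = t ^ (2 ^ Suc n)" by (simp add: z_def power_mult[symmetric] mult.commute)
  finally show ?case by (simp add: y_def)
qed simp

text \<open>Each squaring consumes its argument as the initial tent iterate, so the chain runs in
  place and leaves \<open>A\<close> untouched.\<close>

lemma in_layer_chain:
  fixes X :: "(real ^ 'd) set"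
  assumes X: "compact X" and "in_layer X H G" "aff_span X G A" "aff_span X G u"
    and u: "\<And>x. x \<in> X \<Longrightarrow> 0 \<le> u x \<and> u x \<le> 1"
  shows "in_layer X (H + n * s) {A, \<lambda>x. (sq_approx s ^^ n) (u x)}"
proof (induction n)
  case 0
  have "in_layer X H {A, u}" using assms(3,4) by (intro in_layer_mix[OF assms(2)]) auto
  then show ?case by simp
next
  case (Suc n)
  let ?y = "\<lambda>x. (sq_approx s ^^ n) (u x)"
  have "in_layer X (H + n * s + s) {A, \<lambda>x. 0 + 1 * sq_approx s (?y x)}"
    by (rule in_layer_square[OF X Suc])
       (use u funpow_sq_approx_unit in \<open>auto intro: aff_span_base aff_span_const\<close>)
  then show ?case by (simp add: algebra_simps)
qed

text \<open>Each \<open>u j\<close> is affine in the inputs, which every layer still carries; hence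
  the powers can be computed one after another while the partial sum is transported.\<close>

lemma in_layer_ridge_sum:
  fixes X :: "(real ^ 'd) set"
  assumes X: "compact X" and "finite J" and aff: "\<And>j. aff_span X {} (u j)"
    and u: "\<And>j x. j \<in> J \<Longrightarrow> x \<in> X \<Longrightarrow> 0 \<le> u j x \<and> u j x \<le> 1"
  shows "in_layer X (card J * (n * s)) {\<lambda>x. \<Sum>j\<in>J. w j * (sq_approx s ^^ n) (u j x)}"
  using assms(2) u
proof (induction J rule: finite_induct)
  case empty
  show ?case by (auto intro!: in_layer_mix[OF in_layer_init[OF X]] aff_span_const)
next
  case (insert i J)
  let ?A = "\<lambda>x. \<Sum>j\<in>J. w j * (sq_approx s ^^ n) (u j x)"
  let ?y = "\<lambda>x. (sq_approx s ^^ n) (u i x)"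
  have "in_layer X (card J * (n * s)) {?A}" using insert by auto
  then have "in_layer X (card J * (n * s) + n * s) {?A, ?y}"
    by (rule in_layer_chain[OF X])
       (use insert.prems in \<open>auto intro: aff_span_base aff_span_trans[OF aff]\<close>)
  moreover have "aff_span X {?A, ?y} (\<lambda>x. w i * ?y x + ?A x)"
    by (intro aff_span_add aff_span_scale aff_span_base) auto
  ultimately have "in_layer X (card J * (n * s) + n * s) {\<lambda>x. w i * ?y x + ?A x}"
    by (elim in_layer_mix) simp
  then show ?case using insert.hyps by (simp add: algebra_simps)
qed

section \<open>Products and Horner's scheme\<close>

text \<open>Polarization of the product. The absolute values are there because
  \<open>sq_approx\<close> is accurate on [0,1] only.\<close>

definition mul_approx :: "nat \<Rightarrow> real \<Rightarrow> real \<Rightarrow> real" where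
  "mul_approx s x z = sq_approx s \<bar>(x + z) / 2\<bar> - sq_approx s \<bar>(x - z) / 2\<bar>"

text \<open>Both squares are overestimated, so the error of the difference is bounded by that of one
  square instead of two.\<close>

lemma mul_approx_error:
  assumes "\<bar>x\<bar> \<le> 1" "\<bar>z\<bar> \<le> 1"
  shows "\<bar>mul_approx s x z - x * z\<bar> \<le> 1 / 4 ^ Suc s"
proof -
  have "((x + z) / 2)\<^sup>2 - ((x - z) / 2)\<^sup>2 = x * z"
    by (simp add: power2_eq_square field_simps)
  moreover have "\<bar>(x + z) / 2\<bar> \<le> 1" "\<bar>(x - z) / 2\<bar> \<le> 1" using assms by auto
  ultimately show ?thesis
    using sq_approx_bounds[of "\<bar>(x + z) / 2\<bar>" s] sq_approx_bounds[of "\<bar>(x - z) / 2\<bar>" s]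
    unfolding mul_approx_def power2_abs by (smt (verit) abs_ge_zero)
qed

text \<open>Two layers serve the absolute values and \<open>2 * s\<close> the squarings. While the
  first square is formed, the half-difference occupies \<open>A\<close>, so no register is left for
  an accumulator.\<close>

lemma in_layer_mul:
  fixes X :: "(real ^ 'd) set"
  assumes X: "compact X" and G: "in_layer X H {z}"
    and x: "\<And>x. x \<in> X \<Longrightarrow> \<bar>x $ i\<bar> \<le> 1" and z: "\<And>x. x \<in> X \<Longrightarrow> \<bar>z x\<bar> \<le> 1"
  shows "in_layer X (H + 2 * (s + 1)) {\<lambda>x. mul_approx s (x $ i) (z x)}"
proof -
  let ?u = "\<lambda>x. (1 / 2) * (x $ i + z x)" and ?v = "\<lambda>x. (1 / 2) * (x $ i - z x)"
  have u: "aff_span X {z} ?u" and v: "aff_span X {z} ?v"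
    by (intro aff_span_scale aff_span_add aff_span_diff aff_span_coord aff_span_base; simp)+
  have uv: "\<bar>?u x\<bar> \<le> 1" "\<bar>?v x\<bar> \<le> 1" if "x \<in> X" for x
    using x[OF that] z[OF that] by auto
  have "in_layer X (Suc H) {?v, \<lambda>x. 0, \<lambda>x. \<bar>?u x\<bar>}"
    by (rule in_layer_abs[OF X G v aff_span_const u])
  then have "in_layer X (Suc H + s) {?v, \<lambda>x. 0 + 1 * sq_approx s \<bar>?u x\<bar>}"
    by (rule in_layer_square[OF X]) (use uv in \<open>auto intro: aff_span_base\<close>)
  then have "in_layer X (Suc (Suc H + s)) {\<lambda>x. 0, \<lambda>x. sq_approx s \<bar>?u x\<bar>, \<lambda>x. \<bar>?v x\<bar>}"
    by (intro in_layer_abs[OF X]) (auto intro: aff_span_base aff_span_const)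
  then have "in_layer X (Suc (Suc H + s) + s)
      {\<lambda>x. 0, \<lambda>x. sq_approx s \<bar>?u x\<bar> + (- 1) * sq_approx s \<bar>?v x\<bar>}"
    by (rule in_layer_square[OF X]) (use uv in \<open>auto intro: aff_span_base aff_span_const\<close>)
  then have "in_layer X (Suc (Suc H + s) + s)
      {\<lambda>x. sq_approx s \<bar>?u x\<bar> + (- 1) * sq_approx s \<bar>?v x\<bar>}"
    by (rule in_layer_mix) (auto intro: aff_span_base)
  moreover have "(\<lambda>x. sq_approx s \<bar>?u x\<bar> + (- 1) * sq_approx s \<bar>?v x\<bar>)
      = (\<lambda>x. mul_approx s (x $ i) (z x))"
    by (simp add: mul_approx_def)
  moreover have "Suc (Suc H + s) + s = H + 2 * (s + 1)" by simp
  ultimately show ?thesis by (simp only:)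
qed

text \<open>Multiplication is a parameter, so that the exact and the approximate scheme share one
  recursion. Coefficients run from the leading one down.\<close>

fun horner :: "(real \<Rightarrow> real \<Rightarrow> real) \<Rightarrow> (nat \<Rightarrow> real) \<Rightarrow> nat \<Rightarrow> real \<Rightarrow> real" where
  "horner m b 0 x = b 0"
| "horner m b (Suc j) x = m x (horner m b j x) + b (Suc j)"

lemma horner_times: "horner (*) b q x = (\<Sum>i\<le>q. b i * x ^ (q - i))"
proof (induction q)
  case (Suc q)
  have "(\<Sum>i\<le>q. b i * x ^ (Suc q - i)) = x * (\<Sum>i\<le>q. b i * x ^ (q - i))"
    unfolding sum_distrib_left by (intro sum.cong) (auto simp: Suc_diff_le)
  then show ?case using Suc by simp
qed simp

text \<open>The two claims feed each other: absolute value at most 1 is what the next product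
  estimate needs, and it follows from the bound on the exact value plus the error so far.\<close>

lemma horner_mul_approx:
  assumes "\<bar>x\<bar> \<le> 1" "(\<Sum>i\<le>q. \<bar>b i\<bar>) + q / 4 ^ Suc s \<le> 1" "j \<le> q"
  shows "\<bar>horner (mul_approx s) b j x - horner (*) b j x\<bar> \<le> j / 4 ^ Suc s
    \<and> \<bar>horner (mul_approx s) b j x\<bar> \<le> 1"
  using assms(3)
proof (induction j)
  case 0
  have "\<bar>b 0\<bar> \<le> (\<Sum>i\<le>q. \<bar>b i\<bar>)" by (rule member_le_sum) auto
  moreover have "0 \<le> q / 4 ^ Suc s" by simp
  ultimately have "\<bar>b 0\<bar> \<le> 1" using assms(2) by linarith
  then show ?case by simp
next
  case (Suc j)
  let ?z = "horner (mul_approx s) b j x" and ?w = "horner (*) b j x"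
  have e: "\<bar>?z - ?w\<bar> \<le> j / 4 ^ Suc s" "\<bar>?z\<bar> \<le> 1" using Suc by auto
  have "\<bar>mul_approx s x ?z - x * ?z\<bar> \<le> 1 / 4 ^ Suc s"
    by (rule mul_approx_error[OF assms(1) e(2)])
  moreover have "\<bar>x * ?z - x * ?w\<bar> \<le> \<bar>?z - ?w\<bar>"
    unfolding right_diff_distrib[symmetric] abs_mult
    using mult_right_mono[OF assms(1), of "\<bar>?z - ?w\<bar>"] by simp
  ultimately have "\<bar>mul_approx s x ?z - x * ?w\<bar> \<le> 1 / 4 ^ Suc s + j / 4 ^ Suc s"
    using e(1) by linarith
  then have err: "\<bar>horner (mul_approx s) b (Suc j) x - horner (*) b (Suc j) x\<bar> \<le> Suc j / 4 ^ Suc s"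
    by (simp add: add_divide_distrib)
  have "\<bar>horner (*) b (Suc j) x\<bar> \<le> (\<Sum>i\<le>Suc j. \<bar>b i\<bar>)"
    unfolding horner_times
    by (rule order.trans[OF sum_abs], rule sum_mono)
       (use assms(1) in \<open>auto simp: abs_mult power_abs intro!: mult_left_le power_le_one\<close>)
  also have "\<dots> \<le> (\<Sum>i\<le>q. \<bar>b i\<bar>)" using Suc.prems by (intro sum_mono2) auto
  finally have "\<bar>horner (*) b (Suc j) x\<bar> \<le> (\<Sum>i\<le>q. \<bar>b i\<bar>)" .
  moreover have "Suc j / 4 ^ Suc s \<le> q / 4 ^ Suc s" using Suc.prems by (intro divide_right_mono) auto
  ultimately show ?case using err assms(2) by linarith
qed

lemma in_layer_horner:
  fixes X :: "(real ^ 'd) set"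
  assumes X: "compact X" and x: "\<And>x. x \<in> X \<Longrightarrow> \<bar>x $ i\<bar> \<le> 1"
    and b: "(\<Sum>i\<le>q. \<bar>b i\<bar>) + q / 4 ^ Suc s \<le> 1" and "j \<le> q"
  shows "in_layer X (j * (2 * (s + 1))) {\<lambda>x. horner (mul_approx s) b j (x $ i)}"
  using assms(4)
proof (induction j)
  case 0
  show ?case by (auto intro!: in_layer_mix[OF in_layer_init[OF X]] aff_span_const)
next
  case (Suc j)
  let ?z = "\<lambda>x. horner (mul_approx s) b j (x $ i)"
  have "in_layer X (j * (2 * (s + 1))) {?z}" using Suc by auto
  then have "in_layer X (j * (2 * (s + 1)) + 2 * (s + 1)) {\<lambda>x. mul_approx s (x $ i) (?z x)}"
    by (rule in_layer_mul[OF X _ x]) (use horner_mul_approx[OF x b] Suc.prems in auto)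
  then have "in_layer X (j * (2 * (s + 1)) + 2 * (s + 1))
      {\<lambda>x. mul_approx s (x $ i) (?z x) + b (Suc j)}"
    by (rule in_layer_mix) (auto intro: aff_span_add aff_span_base aff_span_const)
  then show ?case by (simp add: algebra_simps)
qed

section \<open>Multi-indices\<close>

definition mdeg :: "nat ^ 'd \<Rightarrow> nat" where
  "mdeg k = (\<Sum>i\<in>UNIV. k $ i)"

definition simplex_upto :: "nat \<Rightarrow> (nat ^ 'd) set" where
  "simplex_upto M = {k. mdeg k \<le> M}"

lemma component_le_mdeg: "k $ i \<le> mdeg k"
  unfolding mdeg_def by (rule member_le_sum) auto

section \<open>Sums over boxes and simplices of multi-indices\<close>

lemma bij_box_PiE:
  "bij_betw (\<lambda>k. ($) k) {k :: nat ^ 'd. \<forall>r. k $ r \<le> M} (PiE UNIV (\<lambda>_. {..M}))"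
  by (rule bij_betwI[where g = vec_lambda]) auto

lemma finite_box: "finite {k :: nat ^ 'd. \<forall>r. k $ r \<le> M}"
  using bij_betw_finite[OF bij_box_PiE] by (simp add: finite_PiE)

lemma simplex_subset_box: "simplex_upto M \<subseteq> {k :: nat ^ 'd. \<forall>r. k $ r \<le> M}"
  unfolding simplex_upto_def using component_le_mdeg order.trans by blast

lemma finite_simplex_upto: "finite (simplex_upto M)"
  by (rule finite_subset[OF simplex_subset_box finite_box])

lemma sum_box_prod:
  fixes F :: "'d::finite \<Rightarrow> nat \<Rightarrow> real"
  shows "(\<Sum>k\<in>{k :: nat ^ 'd. \<forall>r. k $ r \<le> M}. \<Prod>r\<in>UNIV. F r (k $ r)) = (\<Prod>r\<in>UNIV. \<Sum>i\<le>M. F r i)"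
proof -
  have "(\<Prod>r\<in>UNIV. \<Sum>i\<le>M. F r i) = (\<Sum>g\<in>PiE UNIV (\<lambda>_. {..M}). \<Prod>r\<in>UNIV. F r (g r))"
    by (rule prod_sum_PiE) auto
  also have "\<dots> = (\<Sum>k\<in>{k :: nat ^ 'd. \<forall>r. k $ r \<le> M}. \<Prod>r\<in>UNIV. F r (k $ r))"
    by (rule sum.reindex_bij_betw[OF bij_box_PiE, symmetric])
  finally show ?thesis ..
qed

text \<open>The simplex is not a product set, but zero terms fill it up to a box, where the sum
  factorizes.\<close>

lemma sum_simplex_prod:
  fixes F :: "'d::finite \<Rightarrow> nat \<Rightarrow> real"
  assumes "\<And>k :: nat ^ 'd. M < mdeg k \<Longrightarrow> (\<And>r. k $ r \<le> M) \<Longrightarrow> \<exists>r. F r (k $ r) = 0"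
  shows "(\<Sum>k\<in>simplex_upto M. \<Prod>r\<in>UNIV. F r (k $ r)) = (\<Prod>r\<in>UNIV. \<Sum>i\<le>M. F r i)"
  unfolding sum_box_prod[symmetric]
proof (rule sum.mono_neutral_left[OF finite_box simplex_subset_box], rule ballI)
  fix k :: "nat ^ 'd" assume "k \<in> {k. \<forall>r. k $ r \<le> M} - simplex_upto M"
  then obtain r where "F r (k $ r) = 0" using assms[of k] by (auto simp: simplex_upto_def)
  then show "(\<Prod>r\<in>UNIV. F r (k $ r)) = 0" by auto
qed

text \<open>Stars and bars: the slack \<open>M - mdeg k\<close>, put in front as an extra entry,
  turns \<open>k\<close> into a list of \<open>CARD('d) + 1\<close> numbers with sum
  \<open>M\<close>.\<close>

lemma card_simplex_upto_le: "card (simplex_upto M :: (nat ^ 'd) set) \<le> (M + CARD('d)) choose CARD('d)"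
proof -
  obtain e where e: "bij_betw e {..<CARD('d)} (UNIV :: 'd set)"
    using ex_bij_betw_nat_finite[of "UNIV :: 'd set"] by (auto simp: atLeast0LessThan)
  define g where "g = (\<lambda>k :: nat ^ 'd. (M - mdeg k) # map (\<lambda>j. k $ e j) [0..<CARD('d)])"
  have "inj_on g (simplex_upto M)"
  proof (rule inj_onI)
    fix k l assume "g k = g l"
    then have eq: "\<forall>j<CARD('d). k $ e j = l $ e j" by (auto simp: g_def)
    have "k $ i = l $ i" for i
    proof -
      obtain j where "j < CARD('d)" "e j = i"
        using e unfolding bij_betw_def by (metis UNIV_I imageE lessThan_iff)
      then show ?thesis using eq by auto
    qed
    then show "k = l" by (simp add: vec_eq_iff)
  qed
  moreover have "g ` simplex_upto M \<subseteq> {l. length l = CARD('d) + 1 \<and> sum_list l = M}"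
  proof (rule image_subsetI)
    fix k :: "nat ^ 'd" assume k: "k \<in> simplex_upto M"
    have "sum_list (map (\<lambda>j. k $ e j) [0..<CARD('d)]) = (\<Sum>j<CARD('d). k $ e j)"
      by (simp add: sum_list_distinct_conv_sum_set atLeast0LessThan)
    also have "\<dots> = mdeg k" unfolding mdeg_def by (rule sum.reindex_bij_betw[OF e])
    finally show "g k \<in> {l. length l = CARD('d) + 1 \<and> sum_list l = M}"
      using k by (simp add: g_def simplex_upto_def)
  qed
  moreover have c: "card {l :: nat list. length l = CARD('d) + 1 \<and> sum_list l = M}
      = (M + CARD('d)) choose M"
    using card_length_sum_list[of "CARD('d) + 1" M] by simp
  moreover have "finite {l :: nat list. length l = CARD('d) + 1 \<and> sum_list l = M}"
    by (rule card_ge_0_finite) (simp only: c, simp)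
  ultimately have "card (simplex_upto M :: (nat ^ 'd) set) \<le> (M + CARD('d)) choose M"
    by (metis card_inj_on_le)
  then show ?thesis using binomial_symmetric[of M "M + CARD('d)"] by simp
qed

text \<open>The \<open>\<nu> n\<close> are multinomial coefficients times powers of
  \<open>K\<close>. A lower bound is kept because one of them later becomes a divisor.\<close>

lemma power_multinomial:
  fixes K :: real
  assumes "K \<ge> 0"
  shows "\<exists>\<nu> :: nat ^ 'd \<Rightarrow> real. (\<forall>n\<in>simplex_upto M. K ^ (M - mdeg n) \<le> \<nu> n) \<and>
    (\<forall>y. (K + (\<Sum>r\<in>UNIV. y r)) ^ M = (\<Sum>n\<in>simplex_upto M. \<nu> n * (\<Prod>r\<in>UNIV. y r ^ (n $ r))))"
proof (induction M)
  case 0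
  have "simplex_upto 0 = {0 :: nat ^ 'd}"
    by (auto simp: simplex_upto_def mdeg_def vec_eq_iff)
  then show ?case by (intro exI[of _ "\<lambda>_. 1"]) simp
next
  case (Suc M)
  then obtain \<nu> :: "nat ^ 'd \<Rightarrow> real" where \<nu>: "\<And>n. n \<in> simplex_upto M \<Longrightarrow> K ^ (M - mdeg n) \<le> \<nu> n"
    and eq: "\<And>y. (K + (\<Sum>r\<in>UNIV. y r)) ^ M
      = (\<Sum>n\<in>simplex_upto M. \<nu> n * (\<Prod>r\<in>UNIV. y r ^ (n $ r)))" by blast
  define up :: "'d \<Rightarrow> nat ^ 'd \<Rightarrow> nat ^ 'd"
    where "up = (\<lambda>r n. \<chi> i. if i = r then Suc (n $ i) else n $ i)"
  define down :: "'d \<Rightarrow> nat ^ 'd \<Rightarrow> nat ^ 'd"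
    where "down = (\<lambda>r n. \<chi> i. if i = r then n $ i - 1 else n $ i)"
  \<comment> \<open>Multiplication by \<open>K\<close> plus the sum of the \<open>y r\<close>
    reaches \<open>n\<close> from \<open>n\<close> itself or from some \<open>down r n\<close>; the
    guard is there because natural subtraction truncates.\<close>
  define \<mu> where "\<mu> = (\<lambda>n. (if mdeg n \<le> M then K * \<nu> n else 0)
    + (\<Sum>r\<in>UNIV. if n $ r > 0 then \<nu> (down r n) else 0))"
  have \<nu>0: "0 \<le> \<nu> n" if "n \<in> simplex_upto M" for n
    using \<nu>[OF that] assms by (meson order.trans zero_le_power)
  have mdeg_split: "mdeg n = n $ r + (\<Sum>i\<in>UNIV - {r}. n $ i)" for n :: "nat ^ 'd" and r
    unfolding mdeg_def by (rule sum.remove) auto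
  have mdeg_up: "mdeg (up r n) = Suc (mdeg n)" for r n
    unfolding mdeg_split[of _ r] by (simp add: up_def)
  have up_down: "up r (down r n) = n" if "n $ r > 0" for r n
    using that by (simp add: up_def down_def vec_eq_iff)
  have down_up: "down r (up r n) = n" for r n
    by (simp add: up_def down_def vec_eq_iff)
  have mdeg_down: "mdeg n = Suc (mdeg (down r n))" if "n $ r > 0" for r n
    using mdeg_up[of r "down r n"] up_down[OF that] by simp
  have down_mem: "down r n \<in> simplex_upto M" if "n \<in> simplex_upto (Suc M)" "n $ r > 0" for r n
    using that mdeg_down[OF that(2)] by (simp add: simplex_upto_def)
  have up_mem: "up r n \<in> simplex_upto (Suc M)" "up r n $ r > 0" if "n \<in> simplex_upto M" for r n
    using that mdeg_up[of r n] by (simp_all add: simplex_upto_def up_def)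
  have "K ^ (Suc M - mdeg n) \<le> \<mu> n" if n: "n \<in> simplex_upto (Suc M)" for n
  proof (cases "mdeg n \<le> M")
    case True
    then have "K * K ^ (M - mdeg n) \<le> K * \<nu> n"
      using \<nu>[of n] assms by (intro mult_left_mono) (auto simp: simplex_upto_def)
    moreover have "0 \<le> (\<Sum>r\<in>UNIV. if n $ r > 0 then \<nu> (down r n) else 0)"
      using \<nu>0 down_mem[OF n] by (intro sum_nonneg) auto
    ultimately show ?thesis using True by (simp add: \<mu>_def Suc_diff_le)
  next
    case False
    \<comment> \<open>In top degree the required bound is \<open>K ^ 0 = 1\<close>, and a single
      predecessor supplies it.\<close>
    with n have m: "mdeg n = Suc M" by (simp add: simplex_upto_def)
    then have "\<exists>r. n $ r > 0" unfolding mdeg_def by (metis gr0I nat.simps(3) sum.neutral)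
    then obtain r where r: "n $ r > 0" by blast
    have "1 \<le> \<nu> (down r n)"
      using \<nu>[OF down_mem[OF n r]] mdeg_down[OF r] m by simp
    also have "\<dots> = (if n $ r > 0 then \<nu> (down r n) else 0)" using r by simp
    also have "\<dots> \<le> (\<Sum>r\<in>UNIV. if n $ r > 0 then \<nu> (down r n) else 0)"
      using \<nu>0 down_mem[OF n] by (intro member_le_sum) auto
    finally show ?thesis using m by (simp add: \<mu>_def)
  qed
  moreover have "(K + (\<Sum>r\<in>UNIV. y r)) ^ Suc M
      = (\<Sum>n\<in>simplex_upto (Suc M). \<mu> n * (\<Prod>r\<in>UNIV. y r ^ (n $ r)))" for y
  proof -
    define Y :: "nat ^ 'd \<Rightarrow> real" where "Y = (\<lambda>n. \<Prod>r\<in>UNIV. y r ^ (n $ r))"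
    have Y_up: "Y (up r n) = y r * Y n" for r n
    proof -
      have "Y m = y r ^ (m $ r) * (\<Prod>i\<in>UNIV - {r}. y i ^ (m $ i))" for m
        unfolding Y_def by (rule prod.remove) auto
      then show ?thesis by (simp add: up_def)
    qed
    have shift: "(\<Sum>n\<in>simplex_upto (Suc M). (if n $ r > 0 then \<nu> (down r n) else 0) * Y n)
        = y r * (\<Sum>n\<in>simplex_upto M. \<nu> n * Y n)" for r
    proof -
      have "(\<Sum>n\<in>simplex_upto (Suc M). (if n $ r > 0 then \<nu> (down r n) else 0) * Y n)
          = (\<Sum>n\<in>{n\<in>simplex_upto (Suc M). n $ r > 0}. \<nu> (down r n) * Y n)"
        by (rule sum.mono_neutral_cong_right[OF finite_simplex_upto]) auto
      also have "\<dots> = (\<Sum>n\<in>simplex_upto M. \<nu> n * (y r * Y n))"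
        by (rule sum.reindex_bij_witness[where i = "up r" and j = "down r"])
           (use down_mem up_mem in \<open>auto simp: up_down down_up Y_up[symmetric]\<close>)
      finally show ?thesis by (simp add: sum_distrib_left mult_ac)
    qed
    have "(\<Sum>n\<in>simplex_upto (Suc M). \<mu> n * Y n)
        = (\<Sum>n\<in>simplex_upto (Suc M). (if mdeg n \<le> M then K * \<nu> n else 0) * Y n)
          + (\<Sum>r\<in>UNIV. \<Sum>n\<in>simplex_upto (Suc M). (if n $ r > 0 then \<nu> (down r n) else 0) * Y n)"
      unfolding \<mu>_def distrib_right sum.distrib sum_distrib_right
      by (simp add: sum.swap[of _ UNIV])
    also have "(\<Sum>n\<in>simplex_upto (Suc M). (if mdeg n \<le> M then K * \<nu> n else 0) * Y n)
        = (\<Sum>n\<in>simplex_upto M. K * \<nu> n * Y n)"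
      by (rule sum.mono_neutral_cong_right[OF finite_simplex_upto]) (auto simp: simplex_upto_def)
    also have "\<dots> + (\<Sum>r\<in>UNIV. \<Sum>n\<in>simplex_upto (Suc M). (if n $ r > 0 then \<nu> (down r n) else 0) * Y n)
        = (K + (\<Sum>r\<in>UNIV. y r)) * (\<Sum>n\<in>simplex_upto M. \<nu> n * Y n)"
    proof -
      have "(\<Sum>n\<in>simplex_upto M. K * \<nu> n * Y n) = K * (\<Sum>n\<in>simplex_upto M. \<nu> n * Y n)"
        by (simp add: sum_distrib_left mult.assoc)
      then show ?thesis by (simp only: shift distrib_right sum_distrib_right)
    qed
    finally show ?thesis using eq[of y] by (simp add: Y_def)
  qed
  ultimately show ?case by blast
qed

section \<open>Extracting coefficients by finite differences\<close>

text \<open>The \<open>i\<close>-th backward difference of \<open>t ^ n\<close> at 0 with unit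
  steps. For \<open>i \<le> M\<close> the terms beyond \<open>i\<close> vanish; the common range
  makes it easy to swap sums.\<close>

definition newton_diff :: "nat \<Rightarrow> nat \<Rightarrow> nat \<Rightarrow> real" where
  "newton_diff M i n = (\<Sum>j\<le>M. (- 1) ^ j * of_nat (i choose j) * (- of_nat j) ^ n)"

text \<open>The coefficient of \<open>t ^ k\<close> in \<open>pochhammer t i / fact i\<close>, the
  \<open>i\<close>-th Newton basis polynomial for the nodes 0, -1, -2, and so on.\<close>

definition newton_coeff :: "nat \<Rightarrow> nat \<Rightarrow> real" where
  "newton_coeff i k = of_nat (stirling i k) / fact i"

text \<open>The signed Pascal matrix is its own inverse: regrouping the two binomials leaves an
  alternating row sum of Pascal's triangle.\<close>

lemma binomial_orthogonality:
  assumes "a \<le> M"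
  shows "(\<Sum>i\<le>M. (- 1) ^ i * of_nat (a choose i) * ((- 1) ^ j * of_nat (i choose j)))
    = (if j = a then 1 else 0 :: real)"
proof (cases "j \<le> a")
  case True
  have "(\<Sum>i\<le>M. (- 1) ^ i * of_nat (a choose i) * ((- 1) ^ j * of_nat (i choose j)))
      = (\<Sum>i=j..a. (- 1) ^ i * of_nat (a choose i) * ((- 1) ^ j * of_nat (i choose j)) :: real)"
    using assms by (intro sum.mono_neutral_right) auto
  also have "\<dots> = (\<Sum>l\<le>a - j. of_nat (a choose j) * ((- 1) ^ l * of_nat ((a - j) choose l)))"
  proof (rule sum.reindex_bij_witness[where i = "\<lambda>l. l + j" and j = "\<lambda>i. i - j"])
    fix i assume i: "i \<in> {j..a}"
    then have c: "(a choose i) * (i choose j) = (a choose j) * ((a - j) choose (i - j))"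
      using choose_mult[of j i a] by auto
    have s: "(- 1) ^ i * (- 1) ^ j = ((- 1) ^ (i - j) :: real)"
      using i by (auto simp: minus_one_power_iff)
    have "(- 1) ^ i * of_nat (a choose i) * ((- 1) ^ j * of_nat (i choose j))
        = ((- 1) ^ i * (- 1) ^ j) * (of_nat ((a choose i) * (i choose j)) :: real)" by simp
    then show "of_nat (a choose j) * ((- 1) ^ (i - j) * of_nat ((a - j) choose (i - j)))
        = (- 1) ^ i * of_nat (a choose i) * ((- 1) ^ j * of_nat (i choose j) :: real)"
      unfolding s c by simp
  qed (use True in auto)
  also have "\<dots> = of_nat (a choose j) * (\<Sum>l\<le>a - j. (- 1) ^ l * of_nat ((a - j) choose l))"
    by (simp add: sum_distrib_left)
  also have "\<dots> = (if j = a then 1 else 0)"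
    using True choose_alternating_sum[where ?'a = real and n = "a - j"] by auto
  finally show ?thesis .
next
  case False
  have "(a choose i) * (i choose j) = 0" for i
    using False by (cases "i \<le> a") auto
  then have "(- 1) ^ i * of_nat (a choose i) * ((- 1) ^ j * of_nat (i choose j)) = (0 :: real)" for i
    by (metis mult_eq_0_iff of_nat_0_eq_iff)
  then have "(\<Sum>i\<le>M. (- 1) ^ i * of_nat (a choose i) * ((- 1) ^ j * of_nat (i choose j)))
      = (0 :: real)" by (simp only: sum.neutral_const)
  then show ?thesis using False by simp
qed

text \<open>Newton's formula at the node \<open>- a\<close>: there the basis polynomials become
  signed binomials, and orthogonality selects the term \<open>j = a\<close>.\<close>

lemma newton_forward:
  assumes "a \<le> M"
  shows "(\<Sum>i\<le>M. newton_diff M i n * pochhammer (- of_nat a) i / fact i) = (- of_nat a :: real) ^ n"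
proof -
  have "pochhammer (- of_nat a) i / fact i = (- 1) ^ i * (of_nat (a choose i) :: real)" for i
    unfolding binomial_gbinomial gbinomial_pochhammer by (simp flip: power_mult_distrib)
  then have "(\<Sum>i\<le>M. newton_diff M i n * pochhammer (- of_nat a) i / fact i)
      = (\<Sum>i\<le>M. newton_diff M i n * ((- 1) ^ i * of_nat (a choose i)))"
    by (simp flip: times_divide_eq_right)
  also have "\<dots> = (\<Sum>j\<le>M. (- of_nat j) ^ n *
      (\<Sum>i\<le>M. (- 1) ^ i * of_nat (a choose i) * ((- 1) ^ j * of_nat (i choose j))))"
    unfolding newton_diff_def sum_distrib_left sum_distrib_right
    by (subst sum.swap) (simp add: mult_ac)
  also have "\<dots> = (\<Sum>j\<le>M. (- of_nat j) ^ n * (if j = a then 1 else 0))"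
    unfolding binomial_orthogonality[OF assms] ..
  also have "\<dots> = (- of_nat a) ^ n"
    using assms by (simp add: if_distrib[of "(*) _"] cong: if_cong)
  finally show ?thesis .
qed

text \<open>Comparison of coefficients: Newton's interpolant and \<open>t ^ n\<close> have degree at
  most \<open>M\<close> and agree at the \<open>M + 1\<close> nodes from 0 down to
  \<open>- M\<close>.\<close>

lemma newton_coeff_diff:
  assumes "n \<le> M" "k \<le> M"
  shows "(\<Sum>i\<le>M. newton_coeff i k * newton_diff M i n) = (if k = n then 1 else 0)"
proof -
  define c where "c = (\<lambda>k. \<Sum>i\<le>M. newton_coeff i k * newton_diff M i n)"
  define b where "b = (\<lambda>k. c k - (if k = n then 1 else 0))"
  have poch: "pochhammer t i / fact i = (\<Sum>k\<le>M. newton_coeff i k * t ^ k)" if "i \<le> M" for i t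
  proof -
    have "pochhammer t i = (\<Sum>k\<le>M. of_nat (stirling i k) * t ^ k)"
      unfolding stirling_pochhammer[symmetric]
      using that by (intro sum.mono_neutral_left) auto
    then show ?thesis by (simp add: newton_coeff_def sum_divide_distrib)
  qed
  have "(\<Sum>k\<le>M. c k * t ^ k) = (\<Sum>i\<le>M. newton_diff M i n * pochhammer t i / fact i)" for t
  proof -
    have "(\<Sum>k\<le>M. c k * t ^ k) = (\<Sum>k\<le>M. \<Sum>i\<le>M. newton_diff M i n * (newton_coeff i k * t ^ k))"
      unfolding c_def sum_distrib_right by (simp add: mult_ac)
    also have "\<dots> = (\<Sum>i\<le>M. newton_diff M i n * (\<Sum>k\<le>M. newton_coeff i k * t ^ k))"
      by (subst sum.swap) (simp add: sum_distrib_left)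
    also have "\<dots> = (\<Sum>i\<le>M. newton_diff M i n * (pochhammer t i / fact i))"
      by (rule sum.cong) (simp_all add: poch)
    finally show ?thesis by simp
  qed
  then have root: "(\<Sum>k\<le>M. b k * (- of_nat a) ^ k) = 0" if "a \<le> M" for a
    using newton_forward[OF that, of n] assms(1)
    by (simp add: b_def left_diff_distrib sum_subtractf if_distrib[of "\<lambda>z. z * _"] cong: if_cong)
  have "b k = 0"
  proof (rule ccontr)
    assume "b k \<noteq> 0"
    then have "\<exists>i\<le>M. b i \<noteq> 0" using assms(2) by blast
    then have fin: "finite {z. (\<Sum>i\<le>M. b i * z ^ i) = 0}"
      and card: "card {z. (\<Sum>i\<le>M. b i * z ^ i) = 0} \<le> M"
      using polyfun_rootbound[of M b] by blast+
    have "(\<lambda>a. - of_nat a) ` {..M} \<subseteq> {z. (\<Sum>i\<le>M. b i * z ^ i) = 0}" using root by auto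
    then have "card ((\<lambda>a. - of_nat a :: real) ` {..M}) \<le> M"
      using card_mono[OF fin] card by (meson order.trans)
    moreover have "card ((\<lambda>a. - of_nat a :: real) ` {..M}) = Suc M"
      by (subst card_image) (auto simp: inj_on_def)
    ultimately show False by simp
  qed
  then show ?thesis by (simp add: b_def c_def)
qed

text \<open>If \<open>m\<close> were the largest order with a nonzero difference, that term alone
  would give the coefficient of \<open>t ^ m\<close> in Newton's expansion of \<open>t ^ n\<close>,
  which is 0 as \<open>n < m\<close>.\<close>

lemma newton_diff_eq_0:
  assumes "n < i" "i \<le> M"
  shows "newton_diff M i n = 0"
proof (rule ccontr)
  assume "newton_diff M i n \<noteq> 0"
  define I where "I = {i. n < i \<and> i \<le> M \<and> newton_diff M i n \<noteq> 0}"
  define m where "m = Max I"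
  have "finite I" "I \<noteq> {}" using assms \<open>newton_diff M i n \<noteq> 0\<close> by (auto simp: I_def)
  then have "m \<in> I" and max: "\<And>l. l \<in> I \<Longrightarrow> l \<le> m" by (simp_all add: m_def)
  then have m: "n < m" "m \<le> M" "newton_diff M m n \<noteq> 0" by (simp_all add: I_def)
  have "newton_coeff l m * newton_diff M l n = 0" if "l \<le> M" "l \<noteq> m" for l
  proof (cases "l < m")
    case True
    then show ?thesis by (simp add: newton_coeff_def)
  next
    case False
    then have "l \<notin> I" using max[of l] that by auto
    then show ?thesis using False that m by (auto simp: I_def)
  qed
  then have "(\<Sum>l\<le>M. newton_coeff l m * newton_diff M l n)
      = (\<Sum>l\<in>{m}. newton_coeff l m * newton_diff M l n)"
    using m by (intro sum.mono_neutral_right) auto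
  then show False
    using newton_coeff_diff[of n M m] m by (simp add: newton_coeff_def)
qed

lemma newton_coeff_bounds: "0 \<le> newton_coeff i k" "newton_coeff i k \<le> 1"
proof -
  have "stirling i k \<le> fact i"
  proof (cases "k \<le> i")
    case True
    then have "stirling i k \<le> (\<Sum>k\<le>i. stirling i k)" by (intro member_le_sum) auto
    then show ?thesis by (simp add: sum_stirling)
  qed simp
  then have "real (stirling i k) \<le> fact i" by (metis of_nat_fact of_nat_le_iff)
  then show "0 \<le> newton_coeff i k" "newton_coeff i k \<le> 1"
    by (simp_all add: newton_coeff_def)
qed

text \<open>A weight \<open>2\<^sup>-\<^sup>i\<close> makes the bound independent of \<open>M\<close>; otherwise a product over
  all \<open>d\<close> variables would cost a factor growing with \<open>d\<close>.\<close>

lemma sum_newton_coeff: "(\<Sum>i\<le>M. newton_coeff i k / 2 ^ i) \<le> 1"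
\<comment> \<open>Treating the term \<open>i = 0\<close> apart brings the geometric bound down from
  2 to 1.\<close>
proof (cases "k = 0")
  case True
  have "(\<Sum>i\<le>M. newton_coeff i k / 2 ^ i) = (\<Sum>i\<in>{0}. newton_coeff i k / 2 ^ i)"
    using True by (intro sum.mono_neutral_right) (auto simp: newton_coeff_def)
  then show ?thesis using True by (simp add: newton_coeff_def)
next
  case False
  have "(\<Sum>i\<le>M. newton_coeff i k / 2 ^ i) \<le> (\<Sum>i\<in>{1..M}. 1 / 2 ^ i)"
  proof -
    have "(\<Sum>i\<le>M. newton_coeff i k / 2 ^ i) = (\<Sum>i\<in>{1..M}. newton_coeff i k / 2 ^ i)"
      using False by (intro sum.mono_neutral_right) (auto simp: newton_coeff_def not_less_eq_eq)
    also have "\<dots> \<le> (\<Sum>i\<in>{1..M}. 1 / 2 ^ i)"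
      by (intro sum_mono divide_right_mono newton_coeff_bounds) auto
    finally show ?thesis .
  qed
  also have "\<dots> = 1 - 1 / 2 ^ M"
    by (induction M) (auto simp: field_simps)
  also have "\<dots> \<le> 1" by simp
  finally show ?thesis .
qed

text \<open>Taking differences of \<open>(M - j \<bullet> x) ^ M\<close> in the lattice point \<open>j\<close> isolates a single monomial.
  The nodes \<open>- j\<close> are used because the rising factorials expand with nonnegative coefficients.\<close>

lemma monom_val_ridge:
  fixes k :: "nat ^ 'd"
  assumes "mdeg k \<le> M" "M \<ge> 1"
  shows "\<exists>w. (\<forall>x. monom_val x k = (\<Sum>j\<in>simplex_upto M.
      w j * ((real M - (\<Sum>r\<in>UNIV. real (j $ r) * x $ r)) / (2 * real M)) ^ M)) \<and>
    (\<Sum>j\<in>simplex_upto M. \<bar>w j\<bar>) \<le> 8 ^ M * real M ^ mdeg k"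
proof -
  let ?S = "simplex_upto M :: (nat ^ 'd) set"
  obtain \<nu> :: "nat ^ 'd \<Rightarrow> real" where \<nu>: "\<And>n. n \<in> ?S \<Longrightarrow> real M ^ (M - mdeg n) \<le> \<nu> n"
    and pow: "\<And>y. (real M + (\<Sum>r\<in>UNIV. y r)) ^ M = (\<Sum>n\<in>?S. \<nu> n * (\<Prod>r\<in>UNIV. y r ^ (n $ r)))"
    using power_multinomial[of "real M" M] by auto
  have k: "k \<in> ?S" using assms by (simp add: simplex_upto_def)
  have "0 < real M ^ (M - mdeg k)" using assms by simp
  then have \<nu>k: "0 < \<nu> k" using \<nu>[OF k] by linarith
  \<comment> \<open>The weight of the value at \<open>- j\<close> in the functional extracting the
    coefficient with index \<open>k\<close>: one-dimensional Newton functionals multiplied over the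
    coordinates, with \<open>i\<close> restricted to the simplex.\<close>
  define u where "u = (\<lambda>j :: nat ^ 'd. \<Sum>i\<in>?S. \<Prod>r\<in>UNIV.
    newton_coeff (i $ r) (k $ r) * ((- 1) ^ (j $ r) * of_nat ((i $ r) choose (j $ r))))"
  have ortho: "(\<Sum>j\<in>?S. u j * (\<Prod>r\<in>UNIV. (- real (j $ r)) ^ (n $ r))) = (if n = k then 1 else 0)"
    if n: "n \<in> ?S" for n
  proof -
    have nM: "n $ r \<le> M" for r
      using n component_le_mdeg[of n r] by (simp add: simplex_upto_def)
    have kM: "k $ r \<le> M" for r
      using k component_le_mdeg[of k r] by (simp add: simplex_upto_def)
    have inner: "(\<Sum>j\<in>?S. \<Prod>r\<in>UNIV. (- 1) ^ (j $ r) * real ((i $ r) choose (j $ r)) * (- real (j $ r)) ^ (n $ r))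
        = (\<Prod>r\<in>UNIV. newton_diff M (i $ r) (n $ r))" if "i \<in> ?S" for i
      unfolding newton_diff_def
    proof (rule sum_simplex_prod)
      fix j :: "nat ^ 'd" assume "M < mdeg j"
      have "\<exists>r. i $ r < j $ r"
      proof (rule ccontr)
        assume "\<nexists>r. i $ r < j $ r"
        then have "mdeg j \<le> mdeg i" unfolding mdeg_def by (intro sum_mono) (simp add: not_less)
        then show False using \<open>M < mdeg j\<close> that by (simp add: simplex_upto_def)
      qed
      then show "\<exists>r. (- 1) ^ (j $ r) * real ((i $ r) choose (j $ r)) * (- real (j $ r)) ^ (n $ r) = 0"
        by (auto simp: binomial_eq_0)
    qed
    have "(\<Sum>j\<in>?S. u j * (\<Prod>r\<in>UNIV. (- real (j $ r)) ^ (n $ r)))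
        = (\<Sum>i\<in>?S. (\<Prod>r\<in>UNIV. newton_coeff (i $ r) (k $ r)) *
            (\<Sum>j\<in>?S. \<Prod>r\<in>UNIV. (- 1) ^ (j $ r) * real ((i $ r) choose (j $ r)) * (- real (j $ r)) ^ (n $ r)))"
      unfolding u_def sum_distrib_right sum_distrib_left
      by (subst sum.swap) (simp add: prod.distrib mult.assoc)
    also have "\<dots> = (\<Sum>i\<in>?S. \<Prod>r\<in>UNIV. newton_coeff (i $ r) (k $ r) * newton_diff M (i $ r) (n $ r))"
      by (intro sum.cong refl) (subst inner, simp_all add: prod.distrib)
    also have "\<dots> = (\<Prod>r\<in>UNIV. \<Sum>i\<le>M. newton_coeff i (k $ r) * newton_diff M i (n $ r))"
    proof (rule sum_simplex_prod)
      fix i :: "nat ^ 'd" assume "M < mdeg i" and iM: "\<And>r. i $ r \<le> M"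
      have "\<exists>r. n $ r < i $ r"
      proof (rule ccontr)
        assume "\<nexists>r. n $ r < i $ r"
        then have "mdeg i \<le> mdeg n" unfolding mdeg_def by (intro sum_mono) (simp add: not_less)
        then show False using \<open>M < mdeg i\<close> n by (simp add: simplex_upto_def)
      qed
      then obtain r where "n $ r < i $ r" by blast
      then show "\<exists>r. newton_coeff (i $ r) (k $ r) * newton_diff M (i $ r) (n $ r) = 0"
        using newton_diff_eq_0[OF _ iM] by (intro exI[of _ r]) simp
    qed
    also have "\<dots> = (\<Prod>r\<in>UNIV. if k $ r = n $ r then 1 else 0)"
      by (simp add: newton_coeff_diff nM kM)
    also have "\<dots> = (if n = k then 1 else 0)"
      by (auto simp: vec_eq_iff) (metis (full_types))
    finally show ?thesis .
  qed
  \<comment> \<open>Division by \<open>\<nu> k\<close> removes the multinomial coefficient;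
    \<open>(2 * real M) ^ M\<close> undoes the scaling that brings the base into [0,1] on the
    cube.\<close>
  define w where "w = (\<lambda>j. u j * (2 * real M) ^ M / \<nu> k)"
  have "monom_val x k = (\<Sum>j\<in>?S. w j * ((real M - (\<Sum>r\<in>UNIV. real (j $ r) * x $ r)) / (2 * real M)) ^ M)" for x
  proof -
    have split: "(\<Prod>r\<in>UNIV. (- real (j $ r) * x $ r) ^ (n $ r))
        = monom_val x n * (\<Prod>r\<in>UNIV. (- real (j $ r)) ^ (n $ r))" for j n
      unfolding monom_val_def power_mult_distrib prod.distrib by (rule mult.commute)
    have "(\<Sum>j\<in>?S. u j * (real M - (\<Sum>r\<in>UNIV. real (j $ r) * x $ r)) ^ M)
        = (\<Sum>j\<in>?S. u j * (\<Sum>n\<in>?S. \<nu> n * (\<Prod>r\<in>UNIV. (- real (j $ r) * x $ r) ^ (n $ r))))"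
      by (simp add: pow[symmetric] sum_negf)
    also have "\<dots> = (\<Sum>n\<in>?S. \<nu> n * monom_val x n * (\<Sum>j\<in>?S. u j * (\<Prod>r\<in>UNIV. (- real (j $ r)) ^ (n $ r))))"
      unfolding sum_distrib_left
      by (subst sum.swap) (simp only: split mult.assoc mult.left_commute)
    also have "\<dots> = (\<Sum>n\<in>?S. \<nu> n * monom_val x n * (if n = k then 1 else 0))"
      by (simp add: ortho cong: sum.cong)
    also have "\<dots> = \<nu> k * monom_val x k"
      using k by (simp add: finite_simplex_upto if_distrib[of "(*) _"] cong: if_cong)
    finally show ?thesis
      using \<nu>k assms by (simp add: w_def power_divide field_simps flip: sum_divide_distrib)
  qed
  moreover have "(\<Sum>j\<in>?S. \<bar>w j\<bar>) \<le> 8 ^ M * real M ^ mdeg k"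
  proof -
    have "(\<Sum>j\<in>?S. \<bar>u j\<bar>) \<le> (\<Sum>j\<in>?S. \<Sum>i\<in>?S. \<Prod>r\<in>UNIV.
        newton_coeff (i $ r) (k $ r) * real ((i $ r) choose (j $ r)))"
      unfolding u_def
      by (intro sum_mono order.trans[OF sum_abs])
         (simp add: abs_prod abs_mult power_abs newton_coeff_bounds)
    also have "\<dots> = (\<Sum>i\<in>?S. (\<Prod>r\<in>UNIV. newton_coeff (i $ r) (k $ r)) *
        (\<Sum>j\<in>?S. \<Prod>r\<in>UNIV. real ((i $ r) choose (j $ r))))"
      unfolding sum_distrib_left by (subst sum.swap) (simp add: prod.distrib)
    also have "\<dots> \<le> (\<Sum>i\<in>?S. (\<Prod>r\<in>UNIV. newton_coeff (i $ r) (k $ r)) * (\<Prod>r\<in>UNIV. 2 ^ (i $ r)))"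
    proof (intro sum_mono mult_left_mono prod_nonneg ballI newton_coeff_bounds)
      fix i assume i: "i \<in> ?S"
      have "(\<Sum>j\<in>?S. \<Prod>r\<in>UNIV. real ((i $ r) choose (j $ r)))
          \<le> (\<Sum>j\<in>{k :: nat ^ 'd. \<forall>r. k $ r \<le> M}. \<Prod>r\<in>UNIV. real ((i $ r) choose (j $ r)))"
        by (intro sum_mono2 finite_box simplex_subset_box prod_nonneg) auto
      also have "\<dots> = (\<Prod>r\<in>UNIV. \<Sum>j\<le>M. real ((i $ r) choose j))" by (rule sum_box_prod)
      also have "\<dots> = (\<Prod>r\<in>UNIV. 2 ^ (i $ r))"
      proof (rule prod.cong)
        fix r
        have "i $ r \<le> M" using i component_le_mdeg[of i r] by (simp add: simplex_upto_def)
        then have "(\<Sum>j\<le>M. (i $ r) choose j) = (\<Sum>j\<le>i $ r. (i $ r) choose j)"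
          by (intro sum.mono_neutral_right) auto
        also have "\<dots> = 2 ^ (i $ r)" by (rule choose_row_sum)
        finally show "(\<Sum>j\<le>M. real ((i $ r) choose j)) = 2 ^ (i $ r)"
          by (metis (mono_tags, lifting) of_nat_numeral of_nat_power of_nat_sum sum.cong)
      qed simp
      finally show "(\<Sum>j\<in>?S. \<Prod>r\<in>UNIV. real ((i $ r) choose (j $ r))) \<le> (\<Prod>r\<in>UNIV. 2 ^ (i $ r))" .
    qed
    \<comment> \<open>Writing \<open>2 ^ i\<close> as \<open>4 ^ i / 2 ^ i\<close> supplies the
      weights for \<open>sum_newton_coeff\<close>; total degree at most \<open>M\<close> bounds the
      rest by \<open>4 ^ M\<close>.\<close>
    also have "\<dots> \<le> (\<Sum>i\<in>?S. 4 ^ M * (\<Prod>r\<in>UNIV. newton_coeff (i $ r) (k $ r) / 2 ^ (i $ r)))"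
    proof (rule sum_mono)
      fix i assume i: "i \<in> ?S"
      have "(\<Prod>r\<in>UNIV. newton_coeff (i $ r) (k $ r)) * (\<Prod>r\<in>UNIV. 2 ^ (i $ r))
          = 4 ^ mdeg i * (\<Prod>r\<in>UNIV. newton_coeff (i $ r) (k $ r) / 2 ^ (i $ r))"
        unfolding mdeg_def power_sum prod.distrib[symmetric]
        by (intro prod.cong) (simp_all add: field_simps flip: power_mult_distrib)
      also have "\<dots> \<le> 4 ^ M * (\<Prod>r\<in>UNIV. newton_coeff (i $ r) (k $ r) / 2 ^ (i $ r))"
        using i by (intro mult_right_mono prod_nonneg power_increasing)
          (auto simp: simplex_upto_def newton_coeff_bounds)
      finally show "(\<Prod>r\<in>UNIV. newton_coeff (i $ r) (k $ r)) * (\<Prod>r\<in>UNIV. 2 ^ (i $ r))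
        \<le> 4 ^ M * (\<Prod>r\<in>UNIV. newton_coeff (i $ r) (k $ r) / 2 ^ (i $ r))" .
    qed
    also have "\<dots> \<le> 4 ^ M * (\<Sum>i\<in>{k :: nat ^ 'd. \<forall>r. k $ r \<le> M}.
        \<Prod>r\<in>UNIV. newton_coeff (i $ r) (k $ r) / 2 ^ (i $ r))"
      unfolding sum_distrib_left[symmetric]
      by (intro mult_left_mono sum_mono2 finite_box simplex_subset_box prod_nonneg)
         (auto simp: newton_coeff_bounds)
    also have "\<dots> = 4 ^ M * (\<Prod>r\<in>UNIV. \<Sum>i\<le>M. newton_coeff i (k $ r) / 2 ^ i)"
      by (subst sum_box_prod[symmetric]) simp
    also have "\<dots> \<le> 4 ^ M * 1"
      by (intro mult_left_mono prod_le_1 conjI sum_nonneg sum_newton_coeff)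
         (auto simp: newton_coeff_bounds)
    finally have u: "(\<Sum>j\<in>?S. \<bar>u j\<bar>) \<le> 4 ^ M" by simp
    \<comment> \<open>The surplus \<open>real M ^ (M - mdeg k)\<close> cancels against the lower
      bound for \<open>\<nu> k\<close>.\<close>
    have "(2 * real M) ^ M = 2 ^ M * real M ^ mdeg k * real M ^ (M - mdeg k)"
      using assms by (simp add: power_mult_distrib flip: power_add)
    also have "\<dots> \<le> 2 ^ M * real M ^ mdeg k * \<nu> k"
      using \<nu>[OF k] by (intro mult_left_mono) auto
    finally have "(2 * real M) ^ M / \<nu> k \<le> 2 ^ M * real M ^ mdeg k"
      using \<nu>k by (simp add: field_simps)
    then have "(\<Sum>j\<in>?S. \<bar>u j\<bar>) * ((2 * real M) ^ M / \<nu> k) \<le> 4 ^ M * (2 ^ M * real M ^ mdeg k)"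
      using u \<nu>k by (intro mult_mono) auto
    moreover have "(\<Sum>j\<in>?S. \<bar>w j\<bar>) = (\<Sum>j\<in>?S. \<bar>u j\<bar>) * ((2 * real M) ^ M / \<nu> k)"
      using \<nu>k by (simp add: w_def abs_mult sum_distrib_right sum_divide_distrib)
    moreover have "4 ^ M * (2 ^ M * real M ^ mdeg k) = 8 ^ M * real M ^ mdeg k"
      by (simp flip: power_mult_distrib mult.assoc)
    ultimately show ?thesis by simp
  qed
  ultimately show ?thesis by blast
qed

section \<open>Counting layers\<close>

text \<open>The quadratic Taylor bound at 1/4 is 41/32, whose fourth and eighth powers suffice. At 1
  it would give 5/2, too little for the square.\<close>

lemma exp_1_ge: "(5 / 2 :: real) \<le> exp 1" "(29 / 4 :: real) \<le> (exp 1)\<^sup>2"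
proof -
  have "(41 / 32 :: real) \<le> exp (1 / 4)"
    using exp_lower_Taylor_quadratic[of "1 / 4"] by (simp add: power2_eq_square)
  then have "(41 / 32 :: real) ^ 4 \<le> exp (1 / 4) ^ 4" "(41 / 32 :: real) ^ 8 \<le> exp (1 / 4) ^ 8"
    by (intro power_mono; simp)+
  then show "(5 / 2 :: real) \<le> exp 1" "(29 / 4 :: real) \<le> (exp 1)\<^sup>2"
    by (simp_all flip: exp_of_nat_mult) (simp_all add: power_divide)
qed

text \<open>A crude Stirling bound; the induction rests on
  \<open>(1 + 1 / real d) ^ d \<le> exp 1\<close>, and 7/2 is small enough for
  \<open>d = 2\<close>.\<close>

lemma fact_lower_bound:
  assumes "2 \<le> d"
  shows "7 / 2 * real d ^ d \<le> fact d * exp 1 ^ d"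
  using assms
proof (induction d rule: dec_induct)
  case base
  show ?case using exp_1_ge(2) by (simp add: numeral_2_eq_2)
next
  case (step d)
  have d: "0 < real d" using step by simp
  have "(1 + 1 / real d) ^ d \<le> exp (1 / real d) ^ d"
    by (intro power_mono) (use exp_ge_add_one_self[of "1 / real d"] in auto)
  also have "\<dots> = exp 1" using d by (simp flip: exp_of_nat_mult)
  finally have e: "(1 + 1 / real d) ^ d \<le> exp 1" .
  have "real (Suc d) ^ d = real d ^ d * (1 + 1 / real d) ^ d"
    using d by (simp add: field_simps flip: power_mult_distrib)
  then have "7 / 2 * real (Suc d) ^ Suc d
      = real (Suc d) * ((7 / 2 * real d ^ d) * (1 + 1 / real d) ^ d)" by simp
  also have "\<dots> \<le> real (Suc d) * ((fact d * exp 1 ^ d) * exp 1)"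
    by (intro mult_left_mono mult_mono step.IH e) auto
  finally show ?case by (simp add: algebra_simps)
qed

text \<open>Bernoulli's inequality with its next term. For \<open>d \<ge> 2\<close> it yields the
  square of \<open>1 + real d * b / 2\<close> needed in the layer count.\<close>

lemma power_ge_quadratic:
  fixes b :: real
  assumes "0 \<le> b"
  shows "1 + real d * b + real d * (real d - 1) / 2 * b\<^sup>2 \<le> (1 + b) ^ d"
proof (induction d)
  case (Suc d)
  have "0 \<le> real d * (real d - 1) / 2 * b\<^sup>2 * b"
    using assms by (cases d) auto
  moreover have "(1 + b) * (1 + real d * b + real d * (real d - 1) / 2 * b\<^sup>2)
      = 1 + real (Suc d) * b + real (Suc d) * (real (Suc d) - 1) / 2 * b\<^sup>2
        + real d * (real d - 1) / 2 * b\<^sup>2 * b"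
    by (simp add: power2_eq_square field_simps)
  moreover have "(1 + b) * (1 + real d * b + real d * (real d - 1) / 2 * b\<^sup>2) \<le> (1 + b) * (1 + b) ^ d"
    using Suc assms by (intro mult_left_mono) auto
  ultimately show ?case by simp
qed simp

lemma square_le_exp2: "(m + 1) * (m + 9) \<le> 3 * 2 ^ m + (27 :: nat)"
proof (cases "m < 4")
  case True
  then have "m = 0 \<or> m = 1 \<or> m = 2 \<or> m = 3" by auto
  then show ?thesis by auto
next
  case False
  then have "4 \<le> m" by simp
  \<comment> \<open>The second conjunct bounds the increment of the left-hand side and so carries
    the induction.\<close>
  then have "(m + 1) * (m + 9) \<le> 3 * 2 ^ m + 27 \<and> 2 * m + 11 \<le> 3 * 2 ^ m"
    by (induction m rule: dec_induct) (auto simp: algebra_simps)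
  then show ?thesis ..
qed

text \<open>The square of \<open>exp 1 * (q + d) / d\<close> splits into two factors. By the
  Stirling bound, the \<open>d\<close>-th power of the first dominates 7/2 times the number of
  lattice points; 7/2 times that of the second dominates the layers spent per point.\<close>

lemma ridge_depth:
  assumes d: "2 \<le> d" and n: "1 \<le> n" and q: "2 ^ (n - 1) < q"
    and s: "2 * (s + 1) \<le> (n + 8) * q + n + 1"
    and N: "N \<le> (2 ^ n + d) choose d"
    and L: "(exp 1 * (real q + real d) / real d) ^ (2 * d) < real L"
  shows "N * (n * s) + 2 \<le> L"
proof -
  define D where "D = real d"
  define Q where "Q = real q"
  define B where "B = 2 * Q - 2 + D"
  define C where "C = real ((2 ^ n + d) choose d)"
  have "(2 :: nat) ^ n = 2 * 2 ^ (n - 1)" using n by (cases n) auto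
  then have M: "2 ^ n \<le> 2 * q - 2" using q by simp
  have D: "2 \<le> D" using d by (simp add: D_def)
  have "1 \<le> (2 :: nat) ^ (n - 1)" by simp
  then have "2 \<le> q" using q by linarith
  then have Q: "2 \<le> Q" by (simp add: Q_def)
  have B: "0 < B" using D Q by (simp add: B_def)
  have "((2 ^ n + d) choose d) * fact d \<le> (2 ^ n + d) ^ d" by (rule binomial_fact_pow)
  also have "\<dots> \<le> (2 * q - 2 + d) ^ d" using M by (intro power_mono) auto
  finally have "real (((2 ^ n + d) choose d) * fact d) \<le> real ((2 * q - 2 + d) ^ d)"
    by (rule of_nat_mono)
  then have "C * fact d \<le> B ^ d"
    using \<open>2 \<le> q\<close> by (simp add: C_def B_def D_def Q_def of_nat_diff algebra_simps)
  then have "C * fact d * exp 1 ^ d \<le> B ^ d * exp 1 ^ d" by (rule mult_right_mono) simp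
  moreover have "C * (7 / 2 * D ^ d) \<le> C * (fact d * exp 1 ^ d)"
    using fact_lower_bound[OF d] by (intro mult_left_mono) (simp_all add: C_def D_def)
  ultimately have "7 / 2 * C * D ^ d \<le> B ^ d * exp 1 ^ d" by (simp only: mult_ac)
  then have C: "7 / 2 * C \<le> (exp 1 * B / D) ^ d"
    using D by (simp add: power_divide power_mult_distrib field_simps)
  \<comment> \<open>Chosen so that \<open>(Q + D) ^ 2 = D * B * (1 + b)\<close>.\<close>
  define b where "b = (Q\<^sup>2 + 2 * D) / (D * B)"
  have b: "0 \<le> b" using B D by (simp add: b_def)
  have "(exp 1 * (Q + D) / D)\<^sup>2 = (exp 1 * B / D) * (exp 1 * (1 + b))"
    using B D by (simp add: b_def power2_eq_square field_simps) (simp add: B_def algebra_simps)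
  then have \<Lambda>: "(exp 1 * (Q + D) / D) ^ (2 * d) = (exp 1 * B / D) ^ d * (exp 1 ^ d * (1 + b) ^ d)"
    by (simp only: power_mult power_mult_distrib)
  have "D * D / 4 \<le> D * (D - 1) / 2" using D by (simp add: field_simps)
  then have "(D * D / 4) * b\<^sup>2 \<le> D * (D - 1) / 2 * b\<^sup>2" by (intro mult_right_mono) auto
  then have "(1 + D * b / 2)\<^sup>2 \<le> (1 + b) ^ d"
    using power_ge_quadratic[OF b, of d] by (simp add: D_def power2_eq_square field_simps)
  moreover have "exp 1 ^ d = exp 1 ^ 2 * (exp ((D - 2) / 2))\<^sup>2"
    by (simp add: D_def diff_divide_distrib flip: exp_of_nat_mult exp_add)
  moreover have "(D / 2)\<^sup>2 \<le> (exp ((D - 2) / 2))\<^sup>2"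
    using exp_ge_add_one_self[of "(D - 2) / 2"] D by (intro power_mono) (auto simp: field_simps)
  ultimately have "exp 1 ^ 2 * (D / 2)\<^sup>2 * (1 + D * b / 2)\<^sup>2 \<le> exp 1 ^ d * (1 + b) ^ d"
    by (intro mult_mono) auto
  moreover have "(29 / 4) * ((Q + 2)\<^sup>2 / (4 * Q))\<^sup>2 \<le> exp 1 ^ 2 * ((D / 2) * (1 + D * b / 2))\<^sup>2"
  proof (intro mult_mono power_mono exp_1_ge)
    \<comment> \<open>This gets rid of \<open>D\<close>: what remains is an inequality in
      \<open>Q\<close> alone.\<close>
    have "B \<le> D * Q"
      using mult_nonneg_nonneg[of "D - 2" "Q - 1"] D Q by (simp add: B_def algebra_simps)
    then have "(Q + 2)\<^sup>2 / (4 * Q) \<le> D * (Q + 2)\<^sup>2 / (4 * B)"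
      using B Q by (simp add: field_simps mult_left_mono)
    also have "\<dots> \<le> D * (Q\<^sup>2 + 4 * Q - 4 + 4 * D) / (4 * B)"
      using B D Q by (intro divide_right_mono mult_left_mono) (auto simp: power2_eq_square algebra_simps)
    also have "\<dots> = (D / 2) * (1 + D * b / 2)"
      using B D by (simp add: b_def field_simps) (simp add: B_def algebra_simps)
    finally show "(Q + 2)\<^sup>2 / (4 * Q) \<le> (D / 2) * (1 + D * b / 2)" .
  qed (use Q in auto)
  moreover have "real (n * s) + 2 \<le> 7 / 2 * ((29 / 4) * ((Q + 2)\<^sup>2 / (4 * Q))\<^sup>2)"
  proof -
    have "n * (n + 8) \<le> 3 * 2 ^ (n - 1) + 27"
      using square_le_exp2[of "n - 1"] n by (simp add: numeral_eq_Suc)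
    then have n8: "n * (n + 8) \<le> 3 * q + 24" using q by linarith
    have "2 * (n * s) + 2 * n \<le> n * ((n + 8) * q + n + 1)"
      using mult_left_mono[OF s, of n] by (simp add: algebra_simps)
    also have "\<dots> = n * (n + 8) * q + n * (n + 1)" by (simp add: algebra_simps)
    also have "\<dots> \<le> (3 * q + 24) * q + (3 * q + 24)"
      using n8 by (intro add_mono mult_right_mono) (auto simp: algebra_simps)
    finally have "2 * (n * s) + 2 \<le> (3 * q + 24) * (q + 1)" using n by simp
    then have "real (2 * (n * s) + 2) \<le> real ((3 * q + 24) * (q + 1))" by (rule of_nat_mono)
    then have "real (n * s) + 2 \<le> 3 / 2 * Q\<^sup>2 + 27 / 2 * Q + 13"
      by (simp add: Q_def power2_eq_square algebra_simps)
    also have "\<dots> \<le> 203 / 8 * ((Q\<^sup>2 + 8 * Q + 24) / 16)"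
    proof -
      have "0 \<le> Q\<^sup>2 - 10 * Q + 25"
        using zero_le_power2[of "Q - 5"] by (simp add: power2_eq_square algebra_simps)
      moreover have "203 / 8 * ((Q\<^sup>2 + 8 * Q + 24) / 16)
          = 203 / 128 * Q\<^sup>2 + 203 / 16 * Q + 609 / 16" by (simp add: field_simps)
      ultimately show ?thesis using Q by linarith
    qed
    also have "\<dots> \<le> 203 / 8 * ((Q + 2)\<^sup>2 / (4 * Q))\<^sup>2"
    proof (intro mult_left_mono)
      have "((Q + 2)\<^sup>2)\<^sup>2 = (Q\<^sup>2 + 8 * Q + 24) * Q\<^sup>2 + 32 * Q + 16"
        by (simp add: power2_eq_square algebra_simps)
      then have "(Q\<^sup>2 + 8 * Q + 24) * Q\<^sup>2 \<le> ((Q + 2)\<^sup>2)\<^sup>2" using Q by simp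
      then show "(Q\<^sup>2 + 8 * Q + 24) / 16 \<le> ((Q + 2)\<^sup>2 / (4 * Q))\<^sup>2"
        using Q by (simp add: power_divide power_mult_distrib pos_le_divide_eq)
    qed simp
    finally show ?thesis by simp
  qed
  ultimately have r: "real (n * s) + 2 \<le> 7 / 2 * (exp 1 ^ d * (1 + b) ^ d)"
    unfolding power_mult_distrib mult.assoc by linarith
  have "C * (real (n * s) + 2) \<le> C * (7 / 2 * (exp 1 ^ d * (1 + b) ^ d))"
    using r by (intro mult_left_mono) (auto simp: C_def)
  also have "\<dots> \<le> (exp 1 * B / D) ^ d * (exp 1 ^ d * (1 + b) ^ d)"
    using mult_right_mono[OF C, of "exp 1 ^ d * (1 + b) ^ d"] b by simp
  also have "\<dots> < real L" using L \<Lambda> by (simp add: D_def Q_def)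
  finally have "C * (real (n * s) + 2) < real L" .
  moreover have "real N * real (n * s) \<le> C * real (n * s)"
    using N by (intro mult_right_mono) (auto simp: C_def)
  moreover have "1 \<le> C"
  proof -
    have "0 < (2 ^ n + d) choose d" by simp
    then show ?thesis unfolding C_def by linarith
  qed
  ultimately have "real (N * (n * s) + 2) < real L" by (simp add: algebra_simps)
  then show ?thesis by linarith
qed

section \<open>Approximation of polynomials\<close>

lemma compact_cube: "compact (cbox (vec (-1)) (vec 1) :: (real ^ 'd) set)"
  by (rule compact_cbox)

lemma cube_component:
  fixes x :: "real ^ 'd"
  shows "x \<in> cbox (vec (-1)) (vec 1) \<Longrightarrow> \<bar>x $ i\<bar> \<le> 1"
  by (auto simp: mem_box_cart abs_le_iff intro: le_minus_iff[THEN iffD2])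

lemma exp_of_nat_le: "exp (real n) \<le> 4 ^ n"
proof -
  have "exp (real n) = exp 1 ^ n" by (simp flip: exp_of_nat_mult)
  also have "\<dots> \<le> 4 ^ n" using exp_le by (intro power_mono) auto
  finally show ?thesis .
qed

text \<open>The exponent \<open>M = 2 ^ n\<close> with the least \<open>n\<close> such that
  \<open>q \<le> M\<close> makes the ridge powers iterated squares and, for \<open>n > 0\<close>,
  keeps \<open>M\<close> below \<open>2 * q\<close>.\<close>

lemma approx_polynomial_ridge:
  fixes a :: "nat ^ 'd \<Rightarrow> real"
  assumes d: "2 \<le> CARD('d)" and L2: "2 \<le> L"
    and L: "q \<noteq> 0 \<Longrightarrow>
      (exp 1 * (real q + real CARD('d)) / real CARD('d)) ^ (2 * CARD('d)) < real L"
  shows "\<exists>fhat. relu_network_fun L (CARD('d) + 4) fhat \<and> (\<forall>x\<in>cbox (vec (-1)) (vec 1).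
    \<bar>(\<Sum>k\<in>simplex_upto q. a k * monom_val x k) - fhat x\<bar>
      \<le> (\<Sum>k\<in>simplex_upto q. \<bar>a k\<bar>) * exp (- real (Suc q)))"
proof -
  let ?X = "cbox (vec (-1)) (vec 1) :: (real ^ 'd) set"
  have "q < 2 ^ q" by simp
  then have ex: "\<exists>n. q \<le> 2 ^ n" using less_imp_le by blast
  define n where "n = (LEAST n. q \<le> 2 ^ n)"
  define M where "M = (2 :: nat) ^ n"
  have qM: "q \<le> M" using LeastI_ex[OF ex] by (simp add: n_def M_def)
  have M1: "1 \<le> M" by (simp add: M_def)
  have nq: "2 ^ (n - 1) < q" if "n \<noteq> 0"
  proof -
    have "\<not> q \<le> 2 ^ (n - 1)" using not_less_Least[of "n - 1" "\<lambda>n. q \<le> 2 ^ n"] that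
      by (simp add: n_def)
    then show ?thesis by simp
  qed
  \<comment> \<open>\<open>4 ^ Suc s\<close> has to absorb the weights
    \<open>8 ^ M * real M ^ q\<close>, the error factor \<open>2 ^ n\<close> and
    \<open>exp (q + 1)\<close>, together at most 2 to the power \<open>(n + 8) * q + n\<close> when
    \<open>n > 0\<close>. The extra 1 makes up for rounding down.\<close>
  define s where "s = ((n + 8) * q + n + 1) div 2 - 1"
  have s: "2 * (s + 1) \<le> (n + 8) * q + n + 1" "(n + 8) * q + n \<le> 2 * (s + 1)" if "n \<noteq> 0"
  proof -
    have "1 \<le> q" using nq[OF that] by linarith
    then have "2 \<le> (n + 8) * q + n + 1" using that by (simp add: add_mult_distrib)
    moreover have "2 * (t div 2 - 1 + 1) \<le> t \<and> t \<le> 2 * (t div 2 - 1 + 1) + 1" if "2 \<le> t" for t :: nat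
      using that by presburger
    ultimately show "2 * (s + 1) \<le> (n + 8) * q + n + 1" "(n + 8) * q + n \<le> 2 * (s + 1)"
      unfolding s_def by fastforce+
  qed
  let ?S = "simplex_upto M :: (nat ^ 'd) set"
  define u where "u = (\<lambda>j x :: real ^ 'd. (real M - (\<Sum>r\<in>UNIV. real (j $ r) * x $ r)) / (2 * real M))"
  have "\<forall>k. \<exists>w. mdeg k \<le> M \<longrightarrow> (\<forall>x. monom_val x k = (\<Sum>j\<in>?S. w j * u j x ^ M)) \<and>
      (\<Sum>j\<in>?S. \<bar>w j\<bar>) \<le> 8 ^ M * real M ^ mdeg k"
    unfolding u_def using monom_val_ridge[OF _ M1] by blast
  from choice[OF this] obtain w where w: "\<And>k x. mdeg k \<le> M \<Longrightarrow> monom_val x k = (\<Sum>j\<in>?S. w k j * u j x ^ M)"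
      "\<And>k. mdeg k \<le> M \<Longrightarrow> (\<Sum>j\<in>?S. \<bar>w k j\<bar>) \<le> 8 ^ M * real M ^ mdeg k"
    by blast
  \<comment> \<open>Merging the weights of all monomials lets each power be computed only
    once.\<close>
  define W where "W = (\<lambda>j. \<Sum>k\<in>simplex_upto q. a k * w k j)"
  define g where "g = (\<lambda>x. \<Sum>j\<in>?S. W j * (sq_approx s ^^ n) (u j x))"
  have u01: "0 \<le> u j x \<and> u j x \<le> 1" if "j \<in> ?S" "x \<in> ?X" for j x
  proof -
    have "\<bar>\<Sum>r\<in>UNIV. real (j $ r) * x $ r\<bar> \<le> (\<Sum>r\<in>UNIV. real (j $ r) * 1)"
      by (rule order.trans[OF sum_abs], rule sum_mono)
         (use cube_component[OF that(2)] in \<open>simp add: abs_mult mult_left_le\<close>)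
    also have "\<dots> = real (mdeg j)" by (simp add: mdeg_def)
    also have "\<dots> \<le> real M" using that by (simp add: simplex_upto_def)
    finally show ?thesis using M1 by (auto simp: u_def)
  qed
  have "aff_span ?X {} (u j)" for j
  proof -
    have "aff_span ?X {} (\<lambda>x. (1 / (2 * real M)) * (real M - (\<Sum>r\<in>UNIV. real (j $ r) * x $ r)))"
      by (intro aff_span_scale aff_span_diff aff_span_const aff_span_sum aff_span_coord) simp
    then show ?thesis by (simp add: u_def)
  qed
  then have "in_layer ?X (card ?S * (n * s)) {g}"
    unfolding g_def by (intro in_layer_ridge_sum compact_cube finite_simplex_upto u01)
  moreover have "card ?S * (n * s) + 2 \<le> L"
  \<comment> \<open>\<open>n = 0\<close> means \<open>q \<le> 1\<close>: the polynomial is affine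
    and no squaring takes place.\<close>
  proof (cases "n = 0")
    case False
    have "q \<noteq> 0" using nq[OF False] by linarith
    then show ?thesis
      using ridge_depth[OF d _ nq s(1) _ L] False card_simplex_upto_le[where 'd = 'd, of M]
      by (simp add: M_def)
  qed (use L2 in simp)
  ultimately obtain fhat where net: "relu_network_fun L (CARD('d) + 4) fhat"
    and fhat: "\<And>x. x \<in> ?X \<Longrightarrow> fhat x = g x"
    using in_layer_network[OF compact_cube] by blast
  define E where "E = (2 ^ n - 1) / (4 :: real) ^ Suc s"
  have E0: "0 \<le> E" by (simp add: E_def)
  have EW: "8 ^ M * real M ^ q * E \<le> exp (- real (Suc q))"
  proof (cases "n = 0")
    case True
    then show ?thesis by (simp add: E_def)
  next
    case False
    have e: "exp (real (Suc q)) \<le> 2 ^ (2 * Suc q)"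
      using exp_of_nat_le[of "Suc q"] by (simp only: power_mult) simp
    have "(2 :: nat) ^ n = 2 * 2 ^ (n - 1)" using False by (cases n) auto
    then have M2: "M + 2 \<le> 2 * q" using nq[OF False] by (simp add: M_def)
    have "8 ^ M * real M ^ q * 2 ^ n * exp (real (Suc q)) \<le> 8 ^ M * real M ^ q * 2 ^ n * 2 ^ (2 * Suc q)"
      using e by (intro mult_left_mono) auto
    also have "\<dots> = 2 ^ (3 * M + n * q + n + 2 * Suc q)"
      by (simp add: M_def power_add power_mult)
    also have "\<dots> \<le> 2 ^ (2 * Suc s)"
      using s(2)[OF False] M2 by (intro power_increasing) (auto simp: algebra_simps)
    also have "\<dots> = 4 ^ Suc s" by (simp add: power_mult)
    finally have "8 ^ M * real M ^ q * 2 ^ n * exp (real (Suc q)) \<le> 4 ^ Suc s" .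
    then have "8 ^ M * real M ^ q * (2 ^ n / 4 ^ Suc s) \<le> exp (- real (Suc q))"
      by (simp add: exp_minus field_simps del: of_nat_Suc)
    moreover have "E \<le> 2 ^ n / 4 ^ Suc s" unfolding E_def by (intro divide_right_mono) auto
    then have "8 ^ M * real M ^ q * E \<le> 8 ^ M * real M ^ q * (2 ^ n / 4 ^ Suc s)"
      by (intro mult_left_mono) auto
    ultimately show ?thesis by linarith
  qed
  have "\<bar>(\<Sum>k\<in>simplex_upto q. a k * monom_val x k) - fhat x\<bar>
      \<le> (\<Sum>k\<in>simplex_upto q. \<bar>a k\<bar>) * exp (- real (Suc q))" if x: "x \<in> ?X" for x
  proof -
    have "(\<Sum>k\<in>simplex_upto q. a k * monom_val x k) = (\<Sum>k\<in>simplex_upto q. a k * (\<Sum>j\<in>?S. w k j * u j x ^ M))"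
      using w(1) qM by (intro sum.cong) (auto simp: simplex_upto_def)
    also have "\<dots> = (\<Sum>j\<in>?S. W j * u j x ^ M)"
      unfolding W_def sum_distrib_left sum_distrib_right by (subst sum.swap) (simp add: mult_ac)
    finally have "\<bar>(\<Sum>k\<in>simplex_upto q. a k * monom_val x k) - fhat x\<bar>
        = \<bar>\<Sum>j\<in>?S. W j * (u j x ^ M - (sq_approx s ^^ n) (u j x))\<bar>"
      using fhat[OF x] by (simp add: g_def sum_subtractf right_diff_distrib)
    also have "\<dots> \<le> (\<Sum>j\<in>?S. \<bar>W j\<bar> * E)"
    proof (rule order.trans[OF sum_abs], rule sum_mono)
      fix j assume "j \<in> ?S"
      then have "\<bar>u j x ^ M - (sq_approx s ^^ n) (u j x)\<bar> \<le> E"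
        using funpow_sq_approx_error[of "u j x" n s] u01[OF _ x, of j]
        by (simp add: E_def M_def abs_minus_commute)
      then show "\<bar>W j * (u j x ^ M - (sq_approx s ^^ n) (u j x))\<bar> \<le> \<bar>W j\<bar> * E"
        by (simp add: abs_mult mult_left_mono)
    qed
    also have "\<dots> = (\<Sum>j\<in>?S. \<bar>W j\<bar>) * E" by (simp add: sum_distrib_right)
    also have "\<dots> \<le> (\<Sum>j\<in>?S. \<Sum>k\<in>simplex_upto q. \<bar>a k\<bar> * \<bar>w k j\<bar>) * E"
      using E0 unfolding W_def
      by (intro mult_right_mono sum_mono order.trans[OF sum_abs]) (auto simp: abs_mult)
    also have "\<dots> = (\<Sum>k\<in>simplex_upto q. \<bar>a k\<bar> * ((\<Sum>j\<in>?S. \<bar>w k j\<bar>) * E))"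
      by (subst sum.swap) (simp add: sum_distrib_left sum_distrib_right mult.assoc)
    also have "\<dots> \<le> (\<Sum>k\<in>simplex_upto q. \<bar>a k\<bar> * exp (- real (Suc q)))"
    proof (intro sum_mono mult_left_mono)
      fix k :: "nat ^ 'd" assume k: "k \<in> simplex_upto q"
      then have "mdeg k \<le> q" by (simp add: simplex_upto_def)
      have "(\<Sum>j\<in>?S. \<bar>w k j\<bar>) \<le> 8 ^ M * real M ^ mdeg k"
        using w(2)[of k] \<open>mdeg k \<le> q\<close> qM by simp
      also have "\<dots> \<le> 8 ^ M * real M ^ q"
        using \<open>mdeg k \<le> q\<close> M1 by (intro mult_left_mono power_increasing) auto
      finally have "(\<Sum>j\<in>?S. \<bar>w k j\<bar>) * E \<le> 8 ^ M * real M ^ q * E" using E0 by (rule mult_right_mono)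
      then show "(\<Sum>j\<in>?S. \<bar>w k j\<bar>) * E \<le> exp (- real (Suc q))" using EW by linarith
    qed simp
    finally show ?thesis by (simp add: sum_distrib_right)
  qed
  then show ?thesis using net by blast
qed

text \<open>In one variable the ridge decomposition would need more than \<open>O(q\<^sup>2)\<close> layers. Horner's scheme
  merges the accumulator with the factor being multiplied and thus stays within \<open>d + 4\<close> nodes.\<close>

lemma approx_polynomial_horner:
  fixes a :: "nat ^ 'd \<Rightarrow> real"
  assumes d: "CARD('d) = 1" and L2: "2 \<le> L"
    and L: "q \<noteq> 0 \<Longrightarrow>
      (exp 1 * (real q + real CARD('d)) / real CARD('d)) ^ (2 * CARD('d)) < real L"
  shows "\<exists>fhat. relu_network_fun L (CARD('d) + 4) fhat \<and> (\<forall>x\<in>cbox (vec (-1)) (vec 1).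
    \<bar>(\<Sum>k\<in>simplex_upto q. a k * monom_val x k) - fhat x\<bar>
      \<le> (\<Sum>k\<in>simplex_upto q. \<bar>a k\<bar>) * exp (- real (Suc q)))"
proof -
  let ?X = "cbox (vec (-1)) (vec 1) :: (real ^ 'd) set"
  obtain i where i: "(UNIV :: 'd set) = {i}" using d card_1_singletonE by blast
  then have all_i: "r = i" for r :: 'd by auto
  have vec_i: "vec (k $ i) = k" for k :: "nat ^ 'd"
    unfolding vec_eq_iff by (metis all_i vec_component)
  define A where "A = (\<lambda>j. a (vec j))"
  have reindex: "(\<Sum>k\<in>simplex_upto q. h k) = (\<Sum>j\<le>q. h (vec j))" for h :: "nat ^ 'd \<Rightarrow> real"
    by (rule sum.reindex_bij_witness[where i = vec and j = "\<lambda>k. k $ i"])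
       (auto simp: simplex_upto_def mdeg_def i vec_i)
  define S where "S = (\<Sum>k\<in>simplex_upto q. \<bar>a k\<bar>)"
  have S: "S = (\<Sum>j\<le>q. \<bar>A j\<bar>)" unfolding S_def reindex A_def ..
  have "0 \<le> S" unfolding S by (rule sum_nonneg) simp
  have poly: "(\<Sum>k\<in>simplex_upto q. a k * monom_val x k) = (\<Sum>j\<le>q. A j * (x $ i) ^ j)" for x
    unfolding reindex by (simp add: A_def monom_val_def i)
  \<comment> \<open>Then \<open>4 ^ Suc s = 4 ^ q * 4 ^ Suc q\<close>, and the factors dominate
    \<open>2 * q\<close> and \<open>exp (q + 1)\<close>.\<close>
  define s where "s = 2 * q"
  \<comment> \<open>Reversed for the scheme, and scaled so that the absolute values sum to at most
    1/2; the other half is room for errors. If \<open>S = 0\<close>, division by zero makes every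
    \<open>b j\<close> zero.\<close>
  define b where "b = (\<lambda>j. A (q - j) / (2 * S))"
  have rev: "(\<Sum>j\<le>q. h (q - j)) = (\<Sum>j\<le>q. h j)" for h :: "nat \<Rightarrow> real"
    by (rule sum.reindex_bij_witness[where i = "\<lambda>j. q - j" and j = "\<lambda>j. q - j"]) auto
  have "(\<Sum>j\<le>q. \<bar>b j\<bar>) = (\<Sum>j\<le>q. \<bar>A (q - j)\<bar>) / (2 * S)"
    using \<open>0 \<le> S\<close> by (simp add: b_def sum_divide_distrib)
  also have "\<dots> = S / (2 * S)" unfolding S by (subst rev) simp
  also have "\<dots> \<le> 1 / 2" by simp
  finally have b: "(\<Sum>j\<le>q. \<bar>b j\<bar>) \<le> 1 / 2" .
  have q2: "2 * real q \<le> 4 ^ q"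
  proof (induction q)
    case (Suc q)
    have "(1 :: real) \<le> 4 ^ q" by simp
    then have "2 + 2 * real q \<le> 4 * 4 ^ q" using Suc by linarith
    then show ?case by simp
  qed simp
  have "4 ^ q \<le> (4 :: real) ^ Suc s" by (rule power_increasing) (auto simp: s_def)
  then have "real q / 4 ^ Suc s \<le> 1 / 2" using q2 by (simp add: field_simps)
  then have b1: "(\<Sum>j\<le>q. \<bar>b j\<bar>) + real q / 4 ^ Suc s \<le> 1" using b by linarith
  define g where "g = (\<lambda>x :: real ^ 'd. 2 * S * horner (mul_approx s) b q (x $ i))"
  have "in_layer ?X (q * (2 * (s + 1))) {\<lambda>x. horner (mul_approx s) b q (x $ i)}"
    by (rule in_layer_horner[OF compact_cube cube_component b1]) auto
  then have "in_layer ?X (q * (2 * (s + 1))) {g}"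
    by (rule in_layer_mix) (auto simp: g_def intro: aff_span_scale aff_span_base)
  moreover have "q * (2 * (s + 1)) + 2 \<le> L"
  proof (cases "q = 0")
    case False
    have "(5 / 2 * (real q + 1)) ^ 2 \<le> (exp 1 * (real q + 1)) ^ 2"
      using exp_1_ge(1) by (intro power_mono mult_right_mono) auto
    also have "\<dots> < real L" using L[OF False] d by simp
    finally have "(5 / 2 * (real q + 1)) ^ 2 < real L" .
    moreover have "real (q * (2 * (s + 1)) + 2) \<le> (5 / 2 * (real q + 1)) ^ 2"
      by (simp add: s_def power2_eq_square algebra_simps)
    ultimately show ?thesis by linarith
  qed (use L2 in simp)
  ultimately obtain fhat where net: "relu_network_fun L (CARD('d) + 4) fhat"
    and fhat: "\<And>x. x \<in> ?X \<Longrightarrow> fhat x = g x"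
    using in_layer_network[OF compact_cube] by blast
  have e: "2 * (real q / 4 ^ Suc s) \<le> exp (- real (Suc q))"
  proof -
    have "2 * real q * exp (real (Suc q)) \<le> 4 ^ q * 4 ^ Suc q"
      by (intro mult_mono q2 exp_of_nat_le) auto
    also have "\<dots> = 4 ^ Suc s" by (simp add: s_def power_add[symmetric] mult_2)
    finally show ?thesis by (simp add: exp_minus field_simps del: of_nat_Suc)
  qed
  have "\<bar>(\<Sum>k\<in>simplex_upto q. a k * monom_val x k) - fhat x\<bar> \<le> S * exp (- real (Suc q))"
    if x: "x \<in> ?X" for x
  proof -
    have "2 * S * horner (*) b q (x $ i) = (\<Sum>j\<le>q. A j * (x $ i) ^ j)"
    proof (cases "S = 0")
      case True
      then have "\<forall>j\<in>{..q}. \<bar>A j\<bar> = 0" unfolding S by (subst (asm) sum_nonneg_eq_0_iff) auto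
      then show ?thesis using True by simp
    next
      case False
      have "2 * S * horner (*) b q (x $ i) = (\<Sum>j\<le>q. A (q - j) * (x $ i) ^ (q - j))"
        using False by (simp add: horner_times b_def sum_distrib_left)
      also have "\<dots> = (\<Sum>j\<le>q. A j * (x $ i) ^ j)" by (rule rev)
      finally show ?thesis .
    qed
    then have "\<bar>(\<Sum>k\<in>simplex_upto q. a k * monom_val x k) - fhat x\<bar>
        = \<bar>2 * S * (horner (*) b q (x $ i) - horner (mul_approx s) b q (x $ i))\<bar>"
      using fhat[OF x] by (simp add: poly g_def right_diff_distrib)
    also have "\<dots> = 2 * S * \<bar>horner (mul_approx s) b q (x $ i) - horner (*) b q (x $ i)\<bar>"
      using \<open>0 \<le> S\<close> by (simp add: abs_mult abs_minus_commute)
    also have "\<dots> \<le> 2 * S * (real q / 4 ^ Suc s)"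
      using horner_mul_approx[OF cube_component[OF x, of i] b1, of q] \<open>0 \<le> S\<close>
      by (intro mult_left_mono) auto
    also have "\<dots> \<le> S * exp (- real (Suc q))"
      using mult_left_mono[OF e \<open>0 \<le> S\<close>] by (simp add: mult_ac)
    finally show ?thesis .
  qed
  then show ?thesis using net unfolding S_def by blast
qed

section \<open>The power series\<close>

lemma abs_monom_val_le:
  assumes "\<And>i. \<bar>x $ i\<bar> \<le> t"
  shows "\<bar>monom_val x k\<bar> \<le> t ^ mdeg k"
  unfolding monom_val_def mdeg_def power_sum abs_prod power_abs
  using assms by (intro prod_mono) (auto intro: power_mono)

text \<open>\<open>nonzero\<close> is there because for the zero series the right-hand side is 0 and
  no strict inequality can hold at a point; \<open>L \<ge> 2\<close> because there is an output
  layer and at least one hidden layer.\<close>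

theorem theorem6:
  fixes f :: "real ^ 'd \<Rightarrow> real"
    and a :: "nat ^ 'd \<Rightarrow> real"
    and \<delta> :: real
    and L :: nat
  assumes analytic: "real_analytic_on f (box (vec (-1)) (vec 1))"
    and series: "\<And>x. x \<in> box (vec (-1)) (vec 1) \<Longrightarrow>
      ((\<lambda>k. a k * monom_val x k) has_sum f x) UNIV"
    and abs_conv: "\<And>x. x \<in> cbox (vec (-1)) (vec 1) \<Longrightarrow>
      (\<lambda>k. \<bar>a k * monom_val x k\<bar>) summable_on UNIV"
    and nonzero: "\<exists>k. a k \<noteq> 0"
    and \<delta>: "\<delta> > 0"
    and L: "L \<ge> 2"
  shows "\<exists>fhat :: real ^ 'd \<Rightarrow> real.
    relu_network_fun L (CARD('d) + 4) fhat \<and>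
    (\<forall>x \<in> cbox (vec (-1 + \<delta>)) (vec (1 - \<delta>)).
       \<bar>f x - fhat x\<bar> <
         2 * (\<Sum>\<^sub>\<infinity>k\<in>UNIV. \<bar>a k\<bar>) *
         exp (- real CARD('d) * \<delta> *
           (exp (-1) * real L powr (1 / (2 * real CARD('d))) - 1)))"
proof -
  define d where "d = real CARD('d)"
  define R where "R = real L powr (1 / (2 * d))"
  define m where "m = d * (exp (-1) * R - 1)"
  \<comment> \<open>\<open>m \<le> p\<close> serves the error bound, while \<open>q < m\<close> for
    \<open>q > 0\<close> serves the depth. The maximum covers a nonpositive \<open>m\<close>, where
    \<open>q = 0\<close>.\<close>
  define p where "p = max 1 (nat \<lceil>m\<rceil>)"
  define q where "q = p - 1"
  have d: "1 \<le> d" by (simp add: d_def Suc_leI)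
  have p: "1 \<le> p" "m \<le> real p" "p = Suc q" by (auto simp: p_def q_def) linarith
  have depth: "(exp 1 * (real q + d) / d) ^ (2 * CARD('d)) < real L" if "q \<noteq> 0"
  proof -
    have "real q < m" using that by (simp add: q_def p_def split: if_splits) linarith
    then have "exp 1 * (real q + d) / d < R"
      using d by (simp add: m_def exp_minus field_simps)
    then have "(exp 1 * (real q + d) / d) ^ (2 * CARD('d)) < R ^ (2 * CARD('d))"
      using d by (intro power_strict_mono) auto
    also have "R ^ (2 * CARD('d)) = real L"
      using L d by (simp add: R_def d_def powr_powr flip: powr_realpow)
    finally show ?thesis .
  qed
  define c where "c = (\<Sum>\<^sub>\<infinity>k\<in>UNIV. \<bar>a k\<bar>)"
  have "monom_val (vec 1) k = 1" for k :: "nat ^ 'd" by (simp add: monom_val_def)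
  then have sum_a: "(\<lambda>k. \<bar>a k\<bar>) summable_on UNIV"
    using abs_conv[of "vec 1"] by (simp add: mem_box_cart)
  obtain k0 where "a k0 \<noteq> 0" using nonzero by blast
  then have "0 < (\<Sum>k\<in>{k0}. \<bar>a k\<bar>)" by simp
  also have "\<dots> \<le> c"
    unfolding c_def by (rule finite_sum_le_infsum[OF sum_a]) auto
  finally have c: "0 < c" .
  have has_sum_a: "((\<lambda>k. \<bar>a k\<bar>) has_sum c) UNIV"
    using sum_a by (simp add: c_def)
  obtain fhat where net: "relu_network_fun L (CARD('d) + 4) fhat"
    and err: "\<And>x. x \<in> cbox (vec (-1)) (vec 1) \<Longrightarrow>
      \<bar>(\<Sum>k\<in>simplex_upto q. a k * monom_val x k) - fhat x\<bar>
        \<le> (\<Sum>k\<in>simplex_upto q. \<bar>a k\<bar>) * exp (- real p)"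
  proof (cases "CARD('d) = 1")
    case True
    show ?thesis using approx_polynomial_horner[OF True L depth[unfolded d_def], of a] that
      unfolding p(3) by blast
  next
    case False
    then have "2 \<le> CARD('d)" using zero_less_card_finite[where 'a = 'd] by linarith
    then show ?thesis using approx_polynomial_ridge[OF _ L depth[unfolded d_def], of a] that
      unfolding p(3) by blast
  qed
  have "\<bar>f x - fhat x\<bar> < 2 * c * exp (- \<delta> * m)"
    if x: "x \<in> cbox (vec (-1 + \<delta>)) (vec (1 - \<delta>))" for x
  proof -
    have xi: "\<bar>x $ i\<bar> \<le> 1 - \<delta>" for i
      using x by (simp add: mem_box_cart abs_le_iff) (smt (verit))
    \<comment> \<open>The smaller cube contains \<open>x\<close>; for larger \<open>\<delta>\<close>
      it would be empty.\<close>
    have \<delta>1: "\<delta> \<le> 1" using order.trans[OF abs_ge_zero xi] by simp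
    have "- 1 < x $ i \<and> x $ i < 1" for i
      using xi[of i] \<delta> unfolding abs_le_iff by linarith
    then have xbox: "x \<in> box (vec (-1)) (vec 1)" "x \<in> cbox (vec (-1)) (vec 1)"
      by (simp_all add: mem_box_cart less_imp_le)
    have tail: "((\<lambda>k. a k * monom_val x k) has_sum (f x - (\<Sum>k\<in>simplex_upto q. a k * monom_val x k)))
        (UNIV - simplex_upto q)"
      by (rule has_sum_Diff[OF series[OF xbox(1)] has_sum_finite[OF finite_simplex_upto]]) simp
    have bound: "\<bar>a k * monom_val x k\<bar> \<le> \<bar>a k\<bar> * exp (- \<delta> * real p)"
      if "k \<in> UNIV - simplex_upto q" for k
    proof -
      have "\<bar>monom_val x k\<bar> \<le> (1 - \<delta>) ^ mdeg k" by (rule abs_monom_val_le[OF xi])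
      also have "\<dots> \<le> (1 - \<delta>) ^ p"
        using that \<delta> \<delta>1 p(3) by (intro power_decreasing) (auto simp: simplex_upto_def)
      also have "\<dots> \<le> exp (- \<delta>) ^ p"
        using exp_ge_add_one_self[of "- \<delta>"] \<delta>1 by (intro power_mono) auto
      also have "\<dots> = exp (- \<delta> * real p)" by (simp flip: exp_of_nat2_mult)
      finally show ?thesis by (simp add: abs_mult mult_left_mono)
    qed
    have "((\<lambda>k. \<bar>a k\<bar>) has_sum (c - (\<Sum>k\<in>simplex_upto q. \<bar>a k\<bar>))) (UNIV - simplex_upto q)"
      by (rule has_sum_Diff[OF has_sum_a has_sum_finite[OF finite_simplex_upto]]) simp
    then have "norm (f x - (\<Sum>k\<in>simplex_upto q. a k * monom_val x k))
        \<le> (c - (\<Sum>k\<in>simplex_upto q. \<bar>a k\<bar>)) * exp (- \<delta> * real p)"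
      by (intro norm_infsum_le[OF tail has_sum_cmult_left]) (use bound in auto)
    moreover have "\<bar>(\<Sum>k\<in>simplex_upto q. a k * monom_val x k) - fhat x\<bar>
        \<le> (\<Sum>k\<in>simplex_upto q. \<bar>a k\<bar>) * exp (- \<delta> * real p)"
    proof -
      have "exp (- real p) \<le> exp (- \<delta> * real p)" using \<delta> \<delta>1 by (simp add: mult_left_le_one_le)
      then show ?thesis
        using err[OF xbox(2)] by (meson mult_left_mono order.trans sum_nonneg abs_ge_zero)
    qed
    \<comment> \<open>The network error carries the coefficients up to degree \<open>q\<close>, the
      tail the others; with a common exponential they add up to \<open>c\<close>.\<close>
    ultimately have "\<bar>f x - fhat x\<bar> \<le> c * exp (- \<delta> * real p)"
      by (simp add: left_diff_distrib)
    also have "\<dots> \<le> c * exp (- \<delta> * m)"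
      using c \<delta> p(2) by (intro mult_left_mono) auto
    \<comment> \<open>Strictness comes from the factor 2 and from \<open>c > 0\<close>.\<close>
    also have "\<dots> < 2 * c * exp (- \<delta> * m)" using c by simp
    finally show ?thesis .
  qed
  then show ?thesis
    using net by (intro exI[of _ fhat]) (simp add: c_def m_def R_def d_def mult_ac)
qed

end
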